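(* Let $A$ generate a strongly continuous semigroup on the Hilbert space $\mathbb{H}$, let $B\in\mathcal{L}(\mathbb{U},\mathcal{D}(A^* )')$ be an admissible control operator, let $C\in\mathcal{L}(\mathbb{H})$ and $z\in\mathbb{H}$. Assume that $\ker A\cap\ker C=\{0\}$ and that there exist $T_0>0$ and $c>0$ such that $$\int_0^{T_0}\|Ce^{tA}\xi\|_{\mathbb{H}}^2\,dt\ge c\|e^{T_0A}\xi\|_{\mathbb{H}}^2\qquad\forall\xi\in\mathbb{H}.$$ Then there exists a unique pair $(\bar x,\bar u)\in\mathbb{H}\times\mathbb{U}$ such that $A\bar x+B\bar u=0$ and $$\|C\bar x-z\|_{\mathbb{H}}^2+\|\bar u\|_{\mathbb{U}}^2=\inf_{(x,u)\in\mathbb{H}\times\mathbb{U},\ Ax+Bu=0}\left(\|Cx-z\|_{\mathbb{H}}^2+\|u\|_{\mathbb{U}}^2\right).$$ If in addition $\ker A^*\cap\ker B^*=\{0\}$ and there exists $c>0$ such that $$\int_0^{T_0}\|B^*e^{tA^*}\xi\|_{\mathbb{U}}^2\,dt\ge c\|e^{T_0A^*}\xi\|_{\mathbb{H}}^2\qquad\forall\xi\in\mathbb{H},$$ then there exists a unique $\bar y\in\mathcal{D}(A^* )$ such that $$-A^*\bar y-C^*(C\bar x-z)=0\quad\text{and}\quad\bar u=-B^*\bar y.$$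
   Context: $\mathbb{H}$ and $\mathbb{U}$ are Hilbert spaces, identified with their duals. $A:\mathcal{D}(A)\to\mathbb{H}$ generates a strongly continuous semigroup $(e^{tA})_{t\ge0}$; $A^*$ generates the adjoint semigroup. $\mathcal{D}(A^* )$ carries the graph inner product and $\mathcal{D}(A^* )'$ is its dual with respect to the pivot space $\mathbb{H}$; $e^{tA}$ extends to $\mathcal{D}(A^* )'$. For $B\in\mathcal{L}(\mathbb{U},\mathcal{D}(A^* )')$, $B^*\in\mathcal{L}(\mathcal{D}(A^* ),\mathbb{U})$. $B$ is admissible if for all $T>0$ and $u\in L^2((0,T);\mathbb{U})$ the function $t\mapsto\int_0^te^{(t-s)A}Bu(s)\,ds$ belongs to $C([0,T];\mathbb{H})$. For $\xi\in\mathbb{H}$, $t\mapsto B^*e^{tA^*}\xi\in L^2((0,T_0);\mathbb{U})$ is defined by continuous extension from $\xi\in\mathcal{D}(A^* )$ (possible by admissibility). $Ax+Bu=0$ means $\langle x,A^*\varphi\rangle_{\mathbb{H}}+\langle u,B^*\varphi\rangle_{\mathbb{U}}=0$ for all $\varphi\in\mathcal{D}(A^* )$. *)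

theory Defs
  imports "HOL-Analysis.Analysis"
begin

text \<open>Hilbert spaces are types of sort {real_inner, complete_space}; no separability is assumed.
  An unbounded operator is given by its domain D and a function A whose values outside D are
  irrelevant.\<close>

definition strongly_continuous_semigroup :: "(real \<Rightarrow> 'h::real_normed_vector \<Rightarrow> 'h) \<Rightarrow> bool" where
  "strongly_continuous_semigroup S \<longleftrightarrow>
     (\<forall>t\<ge>0. bounded_linear (S t)) \<and>
     (\<forall>x. S 0 x = x) \<and>
     (\<forall>s\<ge>0. \<forall>t\<ge>0. \<forall>x. S (s + t) x = S s (S t x)) \<and>
     (\<forall>x. ((\<lambda>t. S t x) \<longlongrightarrow> x) (at_right 0))"

definition generates ::
  "'h set \<Rightarrow> ('h \<Rightarrow> 'h) \<Rightarrow> (real \<Rightarrow> 'h::real_normed_vector \<Rightarrow> 'h) \<Rightarrow> bool" where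
  "generates D A S \<longleftrightarrow>
     strongly_continuous_semigroup S \<and>
     D = {x. \<exists>y. ((\<lambda>t. (S t x - x) /\<^sub>R t) \<longlongrightarrow> y) (at_right 0)} \<and>
     (\<forall>x\<in>D. ((\<lambda>t. (S t x - x) /\<^sub>R t) \<longlongrightarrow> A x) (at_right 0))"

definition adj_dom :: "'h::real_inner set \<Rightarrow> ('h \<Rightarrow> 'h) \<Rightarrow> 'h set" where
  "adj_dom D A = {\<phi>. \<exists>\<psi>. \<forall>x\<in>D. inner (A x) \<phi> = inner x \<psi>}"

text \<open>The description is unique when D is dense, as is the case for a generator.\<close>

definition adj_op :: "'h::real_inner set \<Rightarrow> ('h \<Rightarrow> 'h) \<Rightarrow> 'h \<Rightarrow> 'h" where
  "adj_op D A \<phi> = (THE \<psi>. \<forall>x\<in>D. inner (A x) \<phi> = inner x \<psi>)"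

definition adj_graph_norm :: "'h::real_inner set \<Rightarrow> ('h \<Rightarrow> 'h) \<Rightarrow> 'h \<Rightarrow> real" where
  "adj_graph_norm D A \<phi> = sqrt ((norm \<phi>)\<^sup>2 + (norm (adj_op D A \<phi>))\<^sup>2)"

text \<open>The dual of the domain of the adjoint. Its elements are represented by functions on the whole
  space of which only the values on adj_dom D A matter. A vector x of the pivot space is identified
  with the functional inner x.\<close>

definition adj_dom_dual :: "'h::real_inner set \<Rightarrow> ('h \<Rightarrow> 'h) \<Rightarrow> ('h \<Rightarrow> real) set" where
  "adj_dom_dual D A = {f.
     (\<forall>\<phi>\<in>adj_dom D A. \<forall>\<psi>\<in>adj_dom D A. f (\<phi> + \<psi>) = f \<phi> + f \<psi>) \<and>
     (\<forall>a. \<forall>\<phi>\<in>adj_dom D A. f (a *\<^sub>R \<phi>) = a * f \<phi>) \<and>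
     (\<exists>K. \<forall>\<phi>\<in>adj_dom D A. \<bar>f \<phi>\<bar> \<le> K * adj_graph_norm D A \<phi>)}"

text \<open>Bounded linear maps from U into that dual; the last conjunct says that the dual norm of
  B u is at most K times the norm of u.\<close>

definition control_operator ::
  "'h::real_inner set \<Rightarrow> ('h \<Rightarrow> 'h) \<Rightarrow> ('u::real_inner \<Rightarrow> 'h \<Rightarrow> real) \<Rightarrow> bool" where
  "control_operator D A B \<longleftrightarrow>
     (\<forall>u. B u \<in> adj_dom_dual D A) \<and>
     (\<forall>u v. \<forall>\<phi>\<in>adj_dom D A. B (u + v) \<phi> = B u \<phi> + B v \<phi>) \<and>
     (\<forall>a u. \<forall>\<phi>\<in>adj_dom D A. B (a *\<^sub>R u) \<phi> = a * B u \<phi>) \<and>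
     (\<exists>K\<ge>0. \<forall>u. \<forall>\<phi>\<in>adj_dom D A. \<bar>B u \<phi>\<bar> \<le> K * norm u * adj_graph_norm D A \<phi>)"

text \<open>The adjoint of B, for arguments in adj_dom D A; existence is the Riesz representation in U.\<close>

definition control_adj :: "('u::real_inner \<Rightarrow> 'h \<Rightarrow> real) \<Rightarrow> 'h \<Rightarrow> 'u" where
  "control_adj B \<phi> = (THE v. \<forall>u. inner u v = B u \<phi>)"

text \<open>The continuous extension of the semigroup from the pivot space to adj_dom_dual D A is the
  transpose of the adjoint semigroup, because inner (S t x) \<phi> = inner x (adjoint (S t) \<phi>).\<close>

definition semigroup_ext :: "(real \<Rightarrow> 'h::real_inner \<Rightarrow> 'h) \<Rightarrow> real \<Rightarrow> ('h \<Rightarrow> real) \<Rightarrow> 'h \<Rightarrow> real" where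
  "semigroup_ext S t f = (\<lambda>\<phi>. f (adjoint (S t) \<phi>))"

text \<open>Membership in L2((0,T);U). The library's Bochner integrability requires a second countable
  range; strong measurability is therefore spelled out.\<close>

definition strongly_measurable :: "'a measure \<Rightarrow> ('a \<Rightarrow> 'b::topological_space) \<Rightarrow> bool" where
  "strongly_measurable M f \<longleftrightarrow>
     (\<exists>s. (\<forall>i::nat. simple_function M (s i)) \<and> (AE t in M. (\<lambda>i. s i t) \<longlonglongrightarrow> f t))"

definition L2_on :: "real \<Rightarrow> (real \<Rightarrow> 'u::real_normed_vector) \<Rightarrow> bool" where
  "L2_on T u \<longleftrightarrow>
     strongly_measurable (lebesgue_on {0..T}) u \<and>
     integrable (lebesgue_on {0..T}) (\<lambda>t. (norm (u t))\<^sup>2)"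

text \<open>The integral over (0,t) of a function with values in adj_dom_dual D A, where g is an element
  of that space: equality is tested against every element of adj_dom D A.\<close>

definition is_dual_integral ::
  "'h::real_inner set \<Rightarrow> ('h \<Rightarrow> 'h) \<Rightarrow> real \<Rightarrow> (real \<Rightarrow> 'h \<Rightarrow> real) \<Rightarrow> ('h \<Rightarrow> real) \<Rightarrow> bool" where
  "is_dual_integral D A t F g \<longleftrightarrow>
     (\<forall>\<phi>\<in>adj_dom D A.
        integrable (lebesgue_on {0..t}) (\<lambda>s. F s \<phi>) \<and> g \<phi> = (LINT s|lebesgue_on {0..t}. F s \<phi>))"

definition admissible ::
  "'h::real_inner set \<Rightarrow> ('h \<Rightarrow> 'h) \<Rightarrow> (real \<Rightarrow> 'h \<Rightarrow> 'h) \<Rightarrow> ('u::real_inner \<Rightarrow> 'h \<Rightarrow> real) \<Rightarrow> bool" where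
  "admissible D A S B \<longleftrightarrow>
     (\<forall>T>0. \<forall>u. L2_on T u \<longrightarrow>
        (\<exists>w. continuous_on {0..T} w \<and>
           (\<forall>t\<in>{0..T}.
              is_dual_integral D A t (\<lambda>s. semigroup_ext S (t - s) (B (u s))) (inner (w t)))))"

text \<open>The map sending \<xi> to the function t \<mapsto> B* exp(tA*) \<xi> in L2((0,T);U), extended by continuity from
  adj_dom D A; the selected representative is unique up to null sets when B is admissible.\<close>

definition is_observation_ext ::
  "'h::real_inner set \<Rightarrow> ('h \<Rightarrow> 'h) \<Rightarrow> (real \<Rightarrow> 'h \<Rightarrow> 'h) \<Rightarrow> ('u::real_inner \<Rightarrow> 'h \<Rightarrow> real) \<Rightarrow>
   real \<Rightarrow> 'h \<Rightarrow> (real \<Rightarrow> 'u) \<Rightarrow> bool" where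
  "is_observation_ext D A S B T \<xi> f \<longleftrightarrow>
     L2_on T f \<and>
     (\<forall>X. (\<forall>n. X n \<in> adj_dom D A) \<and> X \<longlonglongrightarrow> \<xi> \<longrightarrow>
        (\<lambda>n. LINT t|lebesgue_on {0..T}.
               (norm (control_adj B (adjoint (S t) (X n)) - f t))\<^sup>2) \<longlonglongrightarrow> 0)"

definition observation ::
  "'h::real_inner set \<Rightarrow> ('h \<Rightarrow> 'h) \<Rightarrow> (real \<Rightarrow> 'h \<Rightarrow> 'h) \<Rightarrow> ('u::real_inner \<Rightarrow> 'h \<Rightarrow> real) \<Rightarrow>
   real \<Rightarrow> 'h \<Rightarrow> real \<Rightarrow> 'u" where
  "observation D A S B T \<xi> = (SOME f. is_observation_ext D A S B T \<xi> f)"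

text \<open>The pairs satisfying A x + B u = 0.\<close>

definition steady_pairs ::
  "'h::real_inner set \<Rightarrow> ('h \<Rightarrow> 'h) \<Rightarrow> ('u::real_inner \<Rightarrow> 'h \<Rightarrow> real) \<Rightarrow> ('h \<times> 'u) set" where
  "steady_pairs D A B = {(x, u).
     \<forall>\<phi>\<in>adj_dom D A. inner x (adj_op D A \<phi>) + inner u (control_adj B \<phi>) = 0}"

definition cost ::
  "('h::real_inner \<Rightarrow> 'h) \<Rightarrow> 'h \<Rightarrow> 'h \<times> 'u::real_inner \<Rightarrow> real" where
  "cost C z = (\<lambda>(x, u). (norm (C x - z))\<^sup>2 + (norm u)\<^sup>2)"

definition optimal_steady_pair ::
  "'h::real_inner set \<Rightarrow> ('h \<Rightarrow> 'h) \<Rightarrow> ('u::real_inner \<Rightarrow> 'h \<Rightarrow> real) \<Rightarrow> ('h \<Rightarrow> 'h) \<Rightarrow> 'h \<Rightarrow>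
   'h \<times> 'u \<Rightarrow> bool" where
  "optimal_steady_pair D A B C z p \<longleftrightarrow>
     p \<in> steady_pairs D A B \<and> cost C z p = (INF q\<in>steady_pairs D A B. cost C z q)"

end

theory Submission
  imports Defs
begin

text \<open>If A x + B u = 0 then S t x - x is, up to sign, the integral of the constant control u, so its norm is at
  most a multiple of that of u on bounded time intervals. Hence the observability inequality makes
  (x, u) \<mapsto> (C x, u) bounded below on the closed subspace of steady pairs; its image is closed, and
  the minimiser is the preimage of the orthogonal projection of (z, 0).

  Dually, the second inequality makes y \<mapsto> (A* y, B* y) bounded below on the domain of A*, so its range
  is closed and is the annihilator of the steady pairs; optimality says that (C*(z - C x), -u) lies in
  that annihilator. Admissibility is needed only to identify the observation of y, for y in the domain of A*,
  with t \<mapsto> B* exp(tA*) y: that requires y \<mapsto> B* exp(tA*) y to be continuous into L2, which is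
  proved by a gliding hump.\<close>

text \<open>Two obstacles shape the estimates: the steady equation is known only when tested against
  the domain of the adjoint, so x need not lie in \<open>D\<close>; and \<open>B'\<close> is bounded
  only for the graph norm. The operator \<open>I t\<close>, the integral of the semigroup over
  [0, t], removes both. Its adjoint \<open>I' t\<close> maps the whole space into the domain of
  \<open>A'\<close>, with \<open>A' (I' t y) = S' t y - y\<close>, so the graph norm of
  \<open>I' t y\<close> is at most a multiple of the norm of y.

  Coercivity is then one computation done twice. Along an orbit the observed quantity differs from
  its initial value by a drift already under control, the assumed inequality turns this into a bound
  at the final time, and the drift carries that bound back to time 0.

  Admissibility says only that certain integrals are vectors of the state space and offers no
  constant. If no constant existed, one control could be assembled whose integral pairs too strongly
  with a sequence of short vectors. The choice of signs behind this control also yields the uniform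
  boundedness principle, from which the local bound of the semigroup comes.\<close>

section \<open>Hilbert space tools: projection and Riesz representation\<close>

lemma complete_subspace_orthogonal_projection:
  fixes N :: "'a::{real_inner, complete_space} set"
  assumes N: "subspace N" "closed N"
  obtains p where "p \<in> N" "\<And>q. q \<in> N \<Longrightarrow> inner (a - p) q = 0"
proof -
  define d where "d = (INF q\<in>N. (norm (a - q))\<^sup>2)"
  have bdd: "bdd_below ((\<lambda>q. (norm (a - q))\<^sup>2) ` N)"
    by (rule bdd_belowI[of _ 0]) auto
  have ne: "N \<noteq> {}" using subspace_0[OF N(1)] by auto
  have dle: "d \<le> (norm (a - q))\<^sup>2" if "q \<in> N" for q
    unfolding d_def by (rule cINF_lower[OF bdd that])
  have "\<exists>q\<in>N. (norm (a - q))\<^sup>2 < d + 1 / Suc n" for n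
    using cINF_less_iff[OF ne bdd, of "d + 1 / Suc n"] unfolding d_def by auto
  then obtain q where q: "\<And>n. q n \<in> N" "\<And>n. (norm (a - q n))\<^sup>2 < d + 1 / Suc n" by metis
  \<comment> \<open>Parallelogram law: the midpoint of \<open>q m\<close> and \<open>q n\<close>
    lies in \<open>N\<close>, so its squared distance from \<open>a\<close> is at least
    \<open>d\<close>. Only the excesses over \<open>d\<close> survive, each doubled.\<close>
  have para: "(norm (q m - q n))\<^sup>2 \<le> 2 / Suc m + 2 / Suc n" for m n
  proof -
    have mid: "(1/2) *\<^sub>R (q m + q n) \<in> N"
      using N(1) q(1) by (intro subspace_scale subspace_add)
    have "(norm (q m - q n))\<^sup>2 = 2 * (norm (a - q m))\<^sup>2 + 2 * (norm (a - q n))\<^sup>2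
        - 4 * (norm (a - (1/2) *\<^sub>R (q m + q n)))\<^sup>2"
      by (simp add: power2_norm_eq_inner inner_diff_left inner_diff_right inner_add_left
          inner_add_right inner_commute algebra_simps)
    then show ?thesis using q(2)[of m] q(2)[of n] dle[OF mid] by simp
  qed
  have "Cauchy q"
  proof (rule metric_CauchyI)
    fix e :: real assume e: "e > 0"
    obtain k where k: "4 / real (Suc k) < e\<^sup>2"
      using reals_Archimedean[of "e\<^sup>2 / 4"] e by (auto simp: field_simps)
    show "\<exists>M. \<forall>m\<ge>M. \<forall>n\<ge>M. dist (q m) (q n) < e"
    proof (intro exI allI impI)
      fix m n assume mn: "k \<le> m" "k \<le> n"
      have "2 / real (Suc m) \<le> 2 / real (Suc k)" "2 / real (Suc n) \<le> 2 / real (Suc k)"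
        using mn by (auto simp: field_simps)
      then have "(norm (q m - q n))\<^sup>2 < e\<^sup>2"
        using para[of m n] k by linarith
      then show "dist (q m) (q n) < e"
        using e by (simp add: dist_norm power2_less_imp_less)
    qed
  qed
  then obtain p where p: "q \<longlonglongrightarrow> p" using Cauchy_convergent convergent_def by blast
  have pN: "p \<in> N" using closed_sequentially[OF N(2)] q(1) p by blast
  have "(\<lambda>n. (norm (a - q n))\<^sup>2) \<longlonglongrightarrow> (norm (a - p))\<^sup>2"
    by (intro tendsto_intros p)
  moreover have "(\<lambda>n. d + 1 / real (Suc n)) \<longlonglongrightarrow> d + 0"
    by (intro tendsto_intros LIMSEQ_Suc[OF lim_1_over_n])
  ultimately have "(norm (a - p))\<^sup>2 \<le> d + 0"
    by (rule LIMSEQ_le) (use q(2) in \<open>auto intro: less_imp_le\<close>)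
  then have pd: "(norm (a - p))\<^sup>2 \<le> d" by simp
  have "inner (a - p) r = 0" if r: "r \<in> N" for r
  proof (rule ccontr)
    assume nz: "inner (a - p) r \<noteq> 0"
    \<comment> \<open>The minimiser of the norm of \<open>(a - p) - t *\<^sub>R r\<close> over t;
      there the square falls strictly below the infimum \<open>d\<close>.\<close>
    define t where "t = inner (a - p) r / (norm r)\<^sup>2"
    have r0: "norm r > 0" using nz by auto
    have "p + t *\<^sub>R r \<in> N" using N(1) pN r by (intro subspace_add subspace_scale)
    then have "(norm (a - p))\<^sup>2 \<le> (norm ((a - p) - t *\<^sub>R r))\<^sup>2"
      using dle[of "p + t *\<^sub>R r"] pd unfolding diff_diff_eq by linarith
    also have "\<dots> = (norm (a - p))\<^sup>2 - 2 * t * inner (a - p) r + t\<^sup>2 * (norm r)\<^sup>2"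
      unfolding power2_norm_eq_inner
      by (simp only: inner_diff_left[of "a - p"] inner_diff_right[of _ "a - p"] inner_scaleR_left
        inner_scaleR_right inner_commute[of r "a - p"]) (simp add: algebra_simps power2_eq_square)
    also have "\<dots> = (norm (a - p))\<^sup>2 - (inner (a - p) r)\<^sup>2 / (norm r)\<^sup>2"
      using r0 by (simp add: t_def power2_eq_square field_simps)
    finally show False using nz r0 by (simp add: field_simps)
  qed
  then show thesis using that pN by blast
qed

lemma closure_subspace_is_subspace:
  fixes N :: "'a::real_normed_vector set"
  assumes N: "subspace N"
  shows "subspace (closure N)"
proof (rule subspaceI)
  show "0 \<in> closure N" using subspace_0[OF N] closure_subset by blast
  fix x y assume "x \<in> closure N" "y \<in> closure N"
  then obtain X Y where "\<And>n::nat. X n \<in> N" "X \<longlonglongrightarrow> x" "\<And>n::nat. Y n \<in> N" "Y \<longlonglongrightarrow> y"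
    unfolding closure_sequential by blast
  then show "x + y \<in> closure N"
    unfolding closure_sequential
    by (intro exI[of _ "\<lambda>n. X n + Y n"]) (auto intro: tendsto_add subspace_add[OF N])
next
  fix c :: real and x assume "x \<in> closure N"
  then obtain X where "\<And>n::nat. X n \<in> N" "X \<longlonglongrightarrow> x" unfolding closure_sequential by blast
  then show "c *\<^sub>R x \<in> closure N"
    unfolding closure_sequential
    by (intro exI[of _ "\<lambda>n. c *\<^sub>R X n"])
      (auto intro: tendsto_scaleR tendsto_const subspace_scale[OF N])
qed

text \<open>The kernel of \<open>f\<close> is closed and has codimension one: what remains of a
  vector \<open>a\<close> outside it after projection, \<open>b\<close>, spans the orthogonal
  complement, and \<open>x - (f x / f b) *\<^sub>R b\<close> is in the kernel for every x.\<close>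

lemma Riesz_representation:
  fixes f :: "'a::{real_inner, complete_space} \<Rightarrow> real"
  assumes "bounded_linear f"
  obtains v where "\<And>x. f x = inner x v"
proof (cases "\<forall>x. f x = 0")
  case True
  then show thesis using that[of 0] by simp
next
  case False
  then obtain a where a: "f a \<noteq> 0" by auto
  interpret f: bounded_linear f by fact
  define N where "N = {x. f x = 0}"
  have "subspace N" by (auto simp: N_def subspace_def f.add f.scaleR f.zero)
  moreover have "closed N"
    unfolding N_def by (intro closed_Collect_eq f.continuous_on continuous_on_id continuous_on_const)
  ultimately obtain p where p: "p \<in> N" "\<And>q. q \<in> N \<Longrightarrow> inner (a - p) q = 0"
    using complete_subspace_orthogonal_projection by metis
  define b where "b = a - p"
  have fb: "f b = f a" using p(1) by (simp add: b_def f.diff N_def)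
  have b0: "inner b b \<noteq> 0" using fb a f.zero by force
  have "f x = inner x ((f b / inner b b) *\<^sub>R b)" for x
  proof -
    have "x - (f x / f b) *\<^sub>R b \<in> N" using a fb by (simp add: N_def f.diff f.scaleR)
    then have "inner b (x - (f x / f b) *\<^sub>R b) = 0" using p(2) b_def by blast
    then show ?thesis using a fb b0
      by (simp add: inner_diff_right inner_commute field_simps)
  qed
  then show thesis using that by blast
qed

text \<open>Since \<open>adjoint\<close> is a choice among maps satisfying the identity, some such
  map must first exist; Riesz representation supplies it.\<close>

lemma adjoint_inner:
  fixes f :: "'a::{real_inner, complete_space} \<Rightarrow> 'b::real_inner"
  assumes "bounded_linear f"
  shows "inner (f x) y = inner x (adjoint f y)"
proof -
  have "\<exists>v. \<forall>x. inner (f x) y = inner x v" for y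
    using Riesz_representation[OF bounded_linear_compose[OF bounded_linear_inner_left[of y] assms]]
    by blast
  then obtain g where "\<forall>x y. inner (f x) y = inner x (g y)" by metis
  then show ?thesis using adjoint_unique[of f g] by simp
qed

lemma norm_le_of_inner_le:
  fixes v :: "'a::real_inner"
  assumes "0 \<le> K" "\<And>x. inner x v \<le> K * norm x"
  shows "norm v \<le> K"
proof (cases "v = 0")
  case False
  have "norm v * norm v \<le> K * norm v"
    using assms(2)[of v] by (simp add: dot_square_norm power2_eq_square)
  then show ?thesis using False by simp
qed (use assms in simp)

section \<open>Gliding humps and the uniform boundedness principle\<close>

text \<open>Because 2 v = (p + v) - (p - v), the vectors p + v and p - v cannot both be shorter than
  v. With p the sum of the earlier terms in row n, a sign for the last term can always be picked
  that saves it from cancellation.\<close>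

lemma alternating_signs_sum_norm_ge:
  fixes F :: "nat \<Rightarrow> nat \<Rightarrow> 'a::real_normed_vector"
  obtains e :: "nat \<Rightarrow> real" where "\<And>n. \<bar>e n\<bar> = 1" "\<And>n. norm (F n n) \<le> norm (\<Sum>m\<le>n. e m *\<^sub>R F n m)"
proof -
  have pick: "\<exists>s::real. \<bar>s\<bar> = 1 \<and> norm v \<le> norm (p + s *\<^sub>R v)" for p v :: 'a
  proof (rule ccontr)
    assume "\<not> ?thesis"
    then have no: "\<And>s::real. \<bar>s\<bar> = 1 \<Longrightarrow> norm (p + s *\<^sub>R v) < norm v" by (simp add: not_le)
    have "norm (p + v) < norm v" "norm (p - v) < norm v" using no[of 1] no[of "-1"] by simp_all
    then have "norm ((p + v) - (p - v)) < norm v + norm v"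
      using norm_triangle_ineq4[of "p + v" "p - v"] by simp
    moreover have "(p + v) - (p - v) = 2 *\<^sub>R v" by (simp add: scaleR_2)
    ultimately show False by simp
  qed
  have "\<exists>e. \<forall>n. \<bar>e n\<bar> = 1 \<and> norm (F n n) \<le> norm ((\<Sum>m<n. e m *\<^sub>R F n m) + e n *\<^sub>R F n n)"
  \<comment> \<open>The requirement on \<open>e n\<close> sees the earlier signs only for m < n, so
    the recursion is well founded.\<close>
  proof (rule dependent_wellorder_choice)
    fix r :: real and f g :: "nat \<Rightarrow> real" and n
    assume "\<And>y. y < n \<Longrightarrow> f y = g y"
    then have "(\<Sum>m<n. f m *\<^sub>R F n m) = (\<Sum>m<n. g m *\<^sub>R F n m)" by (intro sum.cong) auto
    then show "(\<bar>r\<bar> = 1 \<and> norm (F n n) \<le> norm ((\<Sum>m<n. f m *\<^sub>R F n m) + r *\<^sub>R F n n)) =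
      (\<bar>r\<bar> = 1 \<and> norm (F n n) \<le> norm ((\<Sum>m<n. g m *\<^sub>R F n m) + r *\<^sub>R F n n))"
      by simp
  qed (rule pick)
  then obtain e :: "nat \<Rightarrow> real" where
    "\<forall>n. \<bar>e n\<bar> = 1 \<and> norm (F n n) \<le> norm ((\<Sum>m<n. e m *\<^sub>R F n m) + e n *\<^sub>R F n n)" by blast
  then show thesis using that[of e] by (simp add: lessThan_Suc_atMost[symmetric])
qed

lemma summable_norm_cancel_complete_space:
  fixes x :: "nat \<Rightarrow> 'a::{real_normed_vector, complete_space}"
  assumes "summable (\<lambda>n. norm (x n))"
  shows "summable x"
proof -
  have "Cauchy (\<lambda>n. sum x {..<n})"
  proof (rule metric_CauchyI)
    fix e :: real assume "e > 0"
    then obtain N where N: "\<And>m n. m \<ge> N \<Longrightarrow> norm (\<Sum>i=m..<n. norm (x i)) < e"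
      using assms unfolding summable_Cauchy by blast
    have *: "dist (sum x {..<m}) (sum x {..<n}) < e" if "N \<le> m" "m \<le> n" for m n
    proof -
      have "norm (\<Sum>i=m..<n. x i) \<le> (\<Sum>i=m..<n. norm (x i))" by (rule norm_sum)
      also have "\<dots> < e" using N[OF that(1), of n] by simp
      finally show ?thesis
        using sum_diff_nat_ivl[of 0 m n x] that
        by (subst dist_commute) (simp add: dist_norm atLeast0LessThan)
    qed
    show "\<exists>M. \<forall>m\<ge>M. \<forall>n\<ge>M. dist (sum x {..<m}) (sum x {..<n}) < e"
    proof (intro exI allI impI)
      fix m n assume "N \<le> m" "N \<le> n"
      then show "dist (sum x {..<m}) (sum x {..<n}) < e"
        using *[of m n] *[of n m] by (cases "m \<le> n") (auto simp: dist_commute)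
    qed
  qed
  then show ?thesis using Cauchy_convergent summable_iff_convergent by blast
qed

lemma norm_suminf_le_complete_space:
  fixes x :: "nat \<Rightarrow> 'a::{real_normed_vector, complete_space}"
  assumes g: "summable g" and le: "\<And>n. norm (x n) \<le> g n"
  shows "norm (suminf x) \<le> suminf g"
proof -
  have s: "summable (\<lambda>n. norm (x n))"
    by (rule summable_comparison_test'[OF g, of 0]) (use le in auto)
  have lim: "(\<lambda>n. norm (\<Sum>i<n. x i)) \<longlonglongrightarrow> norm (suminf x)"
    by (rule tendsto_norm[OF summable_LIMSEQ[OF summable_norm_cancel_complete_space[OF s]]])
  have "norm (\<Sum>i<n. x i) \<le> suminf g" for n
  proof -
    have "norm (\<Sum>i<n. x i) \<le> (\<Sum>i<n. g i)" by (rule sum_norm_le) (use le in auto)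
    also have "\<dots> \<le> suminf g"
      by (rule sum_le_suminf[OF g]) (auto intro: order_trans[OF norm_ge_zero le])
    finally show ?thesis .
  qed
  then show ?thesis by (intro LIMSEQ_le_const2[OF lim]) auto
qed

text \<open>With ratio 1/3 everything after the n-th term adds up to half of that term. A head worth
  more than half of it therefore survives: 3/4 leaves 1/4 in \<open>uniform_boundedness\<close>, and
  the full term leaves 1/2 in \<open>exists_L2_on_integral_inner_ge\<close>.\<close>

lemma suminf_geometric_tail: "(\<Sum>m. K * (1/3::real) ^ (m + Suc n)) = K * (1/3) ^ n / 2"
proof -
  have eq: "(\<lambda>m. K * (1/3::real) ^ (m + Suc n)) = (\<lambda>m. (K * (1/3) ^ Suc n) * (1/3) ^ m)"
    by (simp add: power_add mult_ac)
  have "(\<Sum>m. (1/3::real) ^ m) = 3/2" by (subst suminf_geometric) auto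
  moreover have "summable (\<lambda>m. (1/3::real) ^ m)" by (rule summable_geometric) simp
  ultimately show ?thesis unfolding eq by (subst suminf_mult) auto
qed

text \<open>Gliding hump instead of Baire category. Operators of norm at least 9 ^ n nearly attain
  their norms at unit vectors \<open>x n\<close>; a signed sum of (1/3) ^ m times \<open>x m\<close>
  is sent by the n-th operator to a vector of norm at least 3 ^ n / 4.\<close>

theorem uniform_boundedness:
  fixes T :: "'i \<Rightarrow> 'a::{real_normed_vector, complete_space} \<Rightarrow> 'b::real_normed_vector"
  assumes bl: "\<And>i. i \<in> I \<Longrightarrow> bounded_linear (T i)"
    and ptw: "\<And>x. \<exists>K. \<forall>i\<in>I. norm (T i x) \<le> K"
  shows "\<exists>K. \<forall>i\<in>I. \<forall>x. norm (T i x) \<le> K * norm x"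
proof (rule ccontr)
  assume "\<not> ?thesis"
  \<comment> \<open>The base 9 outgrows the weights (1/3) ^ n, leaving 3 ^ n.\<close>
  then have "\<exists>i\<in>I. \<exists>x. norm (T i x) > 9 ^ n * norm x" for n :: nat
    by (meson not_le)
  then obtain j y where j: "\<And>n::nat. j n \<in> I" and y: "\<And>n. norm (T (j n) (y n)) > 9 ^ n * norm (y n)"
    by metis
  define N where "N n = onorm (T (j n))" for n
  have blj: "bounded_linear (T (j n))" for n using bl j by blast
  have N9: "9 ^ n \<le> N n" for n
  proof (rule ccontr)
    assume "\<not> 9 ^ n \<le> N n"
    then have "N n * norm (y n) \<le> 9 ^ n * norm (y n)" by (intro mult_right_mono) auto
    then show False using y[of n] onorm[OF blj, of n "y n"] by (simp add: N_def)
  qed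
  have Npos: "N n > 0" for n using N9[of n] by (smt (verit) zero_less_power)
  \<comment> \<open>The norm need not be attained; any fraction strictly between 1/2 and 1 would
    beat the tail.\<close>
  have "\<exists>x. norm x = 1 \<and> 3/4 * N n \<le> norm (T (j n) x)" for n
  proof -
    have "\<exists>x. norm (T (j n) x) > 3/4 * N n * norm x"
    proof (rule ccontr)
      assume "\<not> ?thesis"
      then have "N n \<le> 3/4 * N n" using Npos[of n] by (subst N_def, intro onorm_bound) (simp_all add: not_less)
      then show False using Npos[of n] by simp
    qed
    then obtain x where x: "norm (T (j n) x) > 3/4 * N n * norm x" by blast
    then have x0: "x \<noteq> 0" using linear_0[OF bounded_linear.linear[OF blj]] by auto
    have "norm (T (j n) ((1 / norm x) *\<^sub>R x)) = norm (T (j n) x) / norm x"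
      using linear_scale[OF bounded_linear.linear[OF blj]] by simp
    moreover have "3/4 * N n \<le> norm (T (j n) x) / norm x"
      using x x0 by (simp add: field_simps)
    ultimately show ?thesis using x0 by (intro exI[of _ "(1 / norm x) *\<^sub>R x"]) simp
  qed
  then obtain x where x1: "\<And>n. norm (x n) = 1" and xN: "\<And>n. 3/4 * N n \<le> norm (T (j n) (x n))"
    by metis
  obtain e :: "nat \<Rightarrow> real" where e1: "\<And>n. \<bar>e n\<bar> = 1" and
    e: "\<And>n. norm ((1/3) ^ n *\<^sub>R T (j n) (x n))
        \<le> norm (\<Sum>m\<le>n. e m *\<^sub>R ((1/3) ^ m *\<^sub>R T (j n) (x m)))"
    using alternating_signs_sum_norm_ge[of "\<lambda>n m. (1/3) ^ m *\<^sub>R T (j n) (x m)"] by metis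
  define a where "a m = (e m * (1/3) ^ m) *\<^sub>R x m" for m
  have na: "norm (a m) = (1/3) ^ m" for m by (simp add: a_def abs_mult e1 x1)
  have suma: "summable a"
    by (rule summable_norm_cancel_complete_space) (simp add: na summable_geometric)
  have big: "3 ^ n / 4 \<le> norm (T (j n) (suminf a))" for n
  proof -
    interpret T: bounded_linear "T (j n)" by (rule blj)
    have Ta: "T (j n) (a m) = e m *\<^sub>R ((1/3) ^ m *\<^sub>R T (j n) (x m))" for m
      by (simp add: a_def T.scaleR)
    have split: "suminf a = (\<Sum>m. a (m + Suc n)) + sum a {..<Suc n}"
      by (rule suminf_split_initial_segment[OF suma])
    have "norm (\<Sum>m. a (m + Suc n)) \<le> (\<Sum>m. 1 * (1/3) ^ (m + Suc n))"
      by (rule norm_suminf_le_complete_space)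
        (use summable_ignore_initial_segment[of "\<lambda>m. (1/3::real) ^ m" "Suc n"] summable_geometric[of "1/3::real"]
          in \<open>simp_all add: na\<close>)
    then have tail: "norm (\<Sum>m. a (m + Suc n)) \<le> (1/3) ^ n / 2"
      unfolding suminf_geometric_tail by simp
    have "norm (T (j n) (\<Sum>m. a (m + Suc n))) \<le> N n * ((1/3) ^ n / 2)"
      using order_trans[OF onorm[OF blj] mult_left_mono[OF tail]] Npos[of n] by (simp add: N_def)
    moreover have "(1/3) ^ n * (3/4 * N n) \<le> norm (T (j n) (sum a {..<Suc n}))"
    proof -
      have "(1/3) ^ n * (3/4 * N n) \<le> (1/3) ^ n * norm (T (j n) (x n))"
        by (intro mult_left_mono xN) auto
      also have "\<dots> \<le> norm (T (j n) (sum a {..<Suc n}))"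
        using e[of n] by (simp add: T.sum Ta lessThan_Suc_atMost)
      finally show ?thesis .
    qed
    moreover have "norm (T (j n) (sum a {..<Suc n})) - norm (T (j n) (\<Sum>m. a (m + Suc n)))
        \<le> norm (T (j n) (suminf a))"
      unfolding split T.add
      using norm_triangle_ineq4[of "T (j n) (\<Sum>m. a (m + Suc n)) + T (j n) (sum a {..<Suc n})"
        "T (j n) (\<Sum>m. a (m + Suc n))"] by simp
    ultimately have "(1/3) ^ n * N n / 4 \<le> norm (T (j n) (suminf a))" by (simp add: algebra_simps)
    moreover have "(1/3) ^ n * 9 ^ n \<le> (1/3) ^ n * N n" by (intro mult_left_mono N9) auto
    moreover have "(1/3::real) ^ n * 9 ^ n = 3 ^ n" by (simp flip: power_mult_distrib)
    ultimately show ?thesis by linarith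
  qed
  obtain K where K: "\<And>i. i \<in> I \<Longrightarrow> norm (T i (suminf a)) \<le> K" using ptw by blast
  obtain n where "4 * K < 3 ^ n" using real_arch_pow[of 3 "4 * K"] by auto
  then show False using big[of n] K[OF j[of n]] by simp
qed

section \<open>Adjoints of bounded operators\<close>

lemma norm_adjoint_le:
  fixes f :: "'a::{real_inner, complete_space} \<Rightarrow> 'b::real_inner"
  assumes f: "bounded_linear f" and K: "0 \<le> K" "\<And>x. norm (f x) \<le> K * norm x"
  shows "norm (adjoint f y) \<le> K * norm y"
proof (rule norm_le_of_inner_le)
  fix x
  have "inner x (adjoint f y) = inner (f x) y" using adjoint_inner[OF f] by simp
  also have "\<dots> \<le> norm (f x) * norm y" by (rule norm_cauchy_schwarz)
  also have "\<dots> \<le> K * norm x * norm y" by (intro mult_right_mono K) auto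
  finally show "inner x (adjoint f y) \<le> K * norm y * norm x" by (simp add: mult_ac)
qed (use K in simp)

lemma bounded_linear_adjoint:
  fixes f :: "'a::{real_inner, complete_space} \<Rightarrow> 'b::real_inner"
  assumes f: "bounded_linear f"
  shows "bounded_linear (adjoint f)"
proof -
  obtain K where K: "0 \<le> K" "\<And>x. norm (f x) \<le> norm x * K"
    using bounded_linear.nonneg_bounded[OF f] by blast
  show ?thesis
  proof (rule bounded_linear_intro)
    show "adjoint f (x + y) = adjoint f x + adjoint f y" for x y
      by (rule vector_eq_ldot[THEN iffD1])
        (simp add: adjoint_inner[OF f, symmetric] inner_add_right)
    show "adjoint f (r *\<^sub>R x) = r *\<^sub>R adjoint f x" for r x
      by (rule vector_eq_ldot[THEN iffD1]) (simp add: adjoint_inner[OF f, symmetric])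
    show "norm (adjoint f x) \<le> norm x * K" for x
      using norm_adjoint_le[OF f K(1), of x] K(2) by (simp add: mult.commute)
  qed
qed

section \<open>Strongly continuous semigroups and their integrals\<close>

locale c0_semigroup =
  fixes D :: "'h::{real_inner, complete_space} set" and A :: "'h \<Rightarrow> 'h" and S :: "real \<Rightarrow> 'h \<Rightarrow> 'h"
  assumes generates: "generates D A S"
begin

lemma bounded_linear_S: "t \<ge> 0 \<Longrightarrow> bounded_linear (S t)"
  and S_zero [simp]: "S 0 x = x"
  and S_add: "s \<ge> 0 \<Longrightarrow> t \<ge> 0 \<Longrightarrow> S (s + t) x = S s (S t x)"
  and S_tendsto: "((\<lambda>t. S t x) \<longlongrightarrow> x) (at_right 0)"
  using generates unfolding generates_def strongly_continuous_semigroup_def by auto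

lemma D_eq: "D = {x. \<exists>y. ((\<lambda>t. (S t x - x) /\<^sub>R t) \<longlongrightarrow> y) (at_right 0)}"
  and A_tendsto: "x \<in> D \<Longrightarrow> ((\<lambda>t. (S t x - x) /\<^sub>R t) \<longlongrightarrow> A x) (at_right 0)"
  using generates unfolding generates_def by auto

lemma D_I:
  assumes "((\<lambda>t. (S t x - x) /\<^sub>R t) \<longlongrightarrow> y) (at_right 0)"
  shows "x \<in> D" "A x = y"
proof -
  show "x \<in> D" using assms D_eq by auto
  from A_tendsto[OF this] assms show "A x = y"
    by (rule tendsto_unique[rotated]) simp
qed

lemma S_linear:
  assumes "t \<ge> 0"
  shows "S t (x + y) = S t x + S t y" "S t (x - y) = S t x - S t y" "S t (r *\<^sub>R x) = r *\<^sub>R S t x"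
proof -
  interpret bounded_linear "S t" by (rule bounded_linear_S[OF assms])
  show "S t (x + y) = S t x + S t y" "S t (x - y) = S t x - S t y" "S t (r *\<^sub>R x) = r *\<^sub>R S t x"
    by (rule add diff scaleR)+
qed

text \<open>Otherwise there are times \<open>t n\<close> tending to 0 at which the operators admit
  no common bound. Every single orbit converges along these times and is bounded, which contradicts
  uniform boundedness.\<close>

lemma S_bounded_near_zero:
  obtains d K where "d > 0" "\<And>t x. 0 \<le> t \<Longrightarrow> t \<le> d \<Longrightarrow> norm (S t x) \<le> K * norm x"
proof (rule ccontr)
  assume "\<not> thesis"
  then have "\<forall>d>0. \<forall>K. \<exists>t x. 0 \<le> t \<and> t \<le> d \<and> norm (S t x) > K * norm x"
    using that by (meson not_le)
  then have "\<forall>n::nat. \<exists>t x. 0 \<le> t \<and> t \<le> 1 / Suc n \<and> norm (S t x) > real (Suc n) * norm x"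
    by (auto simp del: of_nat_Suc)
  then obtain t x where t: "\<And>n::nat. 0 \<le> t n" "\<And>n. t n \<le> 1 / Suc n"
    and x: "\<And>n. norm (S (t n) (x n)) > real (Suc n) * norm (x n)" by metis
  \<comment> \<open>At time 0 the operator is the identity, whose bound 1 never exceeds
    \<open>Suc n\<close>. Positivity matters because the limit is assumed from the right
    only.\<close>
  have tpos: "t n > 0" for n
  proof (rule ccontr)
    assume "\<not> t n > 0"
    then have "t n = 0" using t(1)[of n] by simp
    then have "norm (x n) > real (Suc n) * norm (x n)" using x[of n] by simp
    moreover have "1 * norm (x n) \<le> real (Suc n) * norm (x n)" by (intro mult_right_mono) auto
    ultimately show False by simp
  qed
  have "t \<longlonglongrightarrow> 0"
    by (rule real_tendsto_sandwich[OF _ _ tendsto_const LIMSEQ_Suc[OF lim_1_over_n]])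
      (use t in auto)
  then have tlim: "filterlim t (at_right 0) sequentially"
    using tpos less_imp_neq[OF tpos, symmetric] by (auto simp: filterlim_at)
  have "\<exists>K. \<forall>n\<in>UNIV. norm (S (t n) y) \<le> K" for y
  proof -
    have "(\<lambda>n. S (t n) y) \<longlonglongrightarrow> y" by (rule filterlim_compose[OF S_tendsto tlim])
    then have "Bseq (\<lambda>n. S (t n) y)" by (intro convergent_imp_Bseq convergentI)
    then show ?thesis by (auto simp: Bseq_def)
  qed
  then obtain K where K: "\<And>n y. norm (S (t n) y) \<le> K * norm y"
    using uniform_boundedness[of UNIV "\<lambda>n. S (t n)"] bounded_linear_S t(1) by blast
  obtain n :: nat where "K < n" using reals_Archimedean2 by blast
  then have "K * norm (x n) \<le> real (Suc n) * norm (x n)" by (intro mult_right_mono) auto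
  then show False using K[of n "x n"] x[of n] by linarith
qed

lemma S_bounded:
  obtains M where "M \<ge> 1" "\<And>t x. 0 \<le> t \<Longrightarrow> t \<le> T \<Longrightarrow> norm (S t x) \<le> M * norm x"
proof -
  obtain d K where d: "d > 0" and K: "\<And>t x. 0 \<le> t \<Longrightarrow> t \<le> d \<Longrightarrow> norm (S t x) \<le> K * norm x"
    using S_bounded_near_zero by blast
  \<comment> \<open>Raising the constant to at least 1 makes its powers increase, so one exponent
    serves all shorter times too.\<close>
  define L where "L = max K 1"
  have L: "norm (S t x) \<le> L * norm x" if "0 \<le> t" "t \<le> d" for t x
    using K[OF that, of x] mult_right_mono[of K L "norm x"] by (simp add: L_def)
  have pow: "norm (S t x) \<le> L ^ Suc n * norm x" if "0 \<le> t" "t \<le> Suc n * d" for n :: nat and t x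
    using that
  proof (induction n arbitrary: t x)
    case 0
    then show ?case using L[of t x] by simp
  next
    case (Suc n)
    show ?case
    proof (cases "t \<le> d")
      case True
      have "L * norm x \<le> L ^ Suc (Suc n) * norm x"
        using power_increasing[of 1 "Suc (Suc n)" L] by (intro mult_right_mono) (auto simp: L_def)
      then show ?thesis using L[OF Suc.prems(1) True, of x] by linarith
    next
      case False
      have "norm (S (d + (t - d)) x) \<le> L * norm (S (t - d) x)"
        using False d L[of d] by (subst S_add) auto
      also have "\<dots> \<le> L * (L ^ Suc n * norm x)"
        by (intro mult_left_mono Suc.IH) (use False Suc.prems in \<open>auto simp: L_def algebra_simps\<close>)
      finally show ?thesis by (simp add: mult.assoc)
    qed
  qed
  obtain n :: nat where n: "T / d < n" using reals_Archimedean2 by blast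
  show thesis
  proof (rule that)
    show "L ^ Suc n \<ge> 1" by (simp add: L_def one_le_power del: power_Suc)
    fix t x assume "0 \<le> t" "t \<le> T"
    moreover have "T \<le> Suc n * d" using n d by (simp add: field_simps)
    ultimately show "norm (S t x) \<le> L ^ Suc n * norm x" by (intro pow) auto
  qed
qed

lemma continuous_on_S: "continuous_on {0..} (\<lambda>t. S t x)"
proof (rule continuous_on_eq_continuous_within[THEN iffD2], intro ballI)
  fix t :: real assume "t \<in> {0..}"
  then have t: "t \<ge> 0" by simp
  obtain M where M: "M \<ge> 1" "\<And>s x. 0 \<le> s \<Longrightarrow> s \<le> t + 1 \<Longrightarrow> norm (S s x) \<le> M * norm x"
    using S_bounded[of "t + 1"] by blast
  show "continuous (at t within {0..}) (\<lambda>t. S t x)"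
    unfolding continuous_within_eps_delta
  proof (intro allI impI)
    fix e :: real assume e: "e > 0"
    have "\<forall>\<^sub>F h in at_right 0. dist (S h x) x < e / M"
      by (rule tendstoD[OF S_tendsto]) (use e M(1) in simp)
    then obtain d where d: "d > 0" "\<And>h. 0 < h \<Longrightarrow> h < d \<Longrightarrow> dist (S h x) x < e / M"
      unfolding eventually_at_right_field by auto
    \<comment> \<open>Only right continuity at 0 is available. Factoring out the earlier time
      \<open>s\<close> and using the uniform bound \<open>M\<close> covers approach from both
      sides.\<close>
    have est: "norm (S r x - S s x) < e" if "0 \<le> s" "s \<le> r" "r - s < d" "r \<le> t + 1" for r s
    proof (cases "r = s")
      case False
      have "S r x - S s x = S s (S (r - s) x - x)"
        using S_add[of s "r - s" x] that by (simp add: S_linear)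
      then have "norm (S r x - S s x) \<le> M * norm (S (r - s) x - x)"
        using M(2)[of s "S (r - s) x - x"] that by simp
      also have "\<dots> < M * (e / M)"
        using d(2)[of "r - s"] that False M(1) by (intro mult_strict_left_mono) (auto simp: dist_norm)
      finally show ?thesis using M(1) by simp
    qed (use e in simp)
    show "\<exists>d>0. \<forall>s\<in>{0..}. dist s t < d \<longrightarrow> dist (S s x) (S t x) < e"
    proof (intro exI conjI ballI impI)
      show "min d 1 > 0" using d by simp
      fix s :: real assume "s \<in> {0..}" "dist s t < min d 1"
      then show "dist (S s x) (S t x) < e"
        using est[of s t] est[of t s] t
        by (cases "s \<le> t") (auto simp: dist_norm norm_minus_commute dist_real_def)
    qed
  qed
qed

lemma continuous_on_inner_S [continuous_intros]: "T \<subseteq> {0..} \<Longrightarrow> continuous_on T (\<lambda>t. inner (S t x) y)"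
  by (intro continuous_on_inner continuous_on_const continuous_on_subset[OF continuous_on_S])

lemma integrable_inner_S: "0 \<le> a \<Longrightarrow> (\<lambda>t. inner (S t x) y) integrable_on {a..b}"
  by (intro integrable_continuous_real continuous_on_inner_S) auto

text \<open>The integral of S s x over [0, t], defined weakly: the library's vector-valued integrals need the
  class banach, which the sort of the state space does not entail.\<close>

definition I :: "real \<Rightarrow> 'h \<Rightarrow> 'h" where
  "I t x = (SOME v. \<forall>y. inner v y = integral {0..t} (\<lambda>s. inner (S s x) y))"

text \<open>The right-hand side is a bounded functional of y, so the choice in \<open>I\<close> has
  a candidate by Riesz representation.\<close>

lemma inner_I:
  assumes t: "t \<ge> 0"
  shows "inner (I t x) y = integral {0..t} (\<lambda>s. inner (S s x) y)"
proof -
  obtain M where M: "M \<ge> 1" "\<And>s x. 0 \<le> s \<Longrightarrow> s \<le> t \<Longrightarrow> norm (S s x) \<le> M * norm x"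
    using S_bounded[of t] by blast
  have "bounded_linear (\<lambda>y. integral {0..t} (\<lambda>s. inner (S s x) y))"
  proof (rule bounded_linear_intro)
    show "integral {0..t} (\<lambda>s. inner (S s x) (y + z)) =
      integral {0..t} (\<lambda>s. inner (S s x) y) + integral {0..t} (\<lambda>s. inner (S s x) z)" for y z
      by (simp add: inner_add_right integral_add integrable_inner_S)
    show "integral {0..t} (\<lambda>s. inner (S s x) (r *\<^sub>R y)) = r *\<^sub>R integral {0..t} (\<lambda>s. inner (S s x) y)"
      for r y by simp
    show "norm (integral {0..t} (\<lambda>s. inner (S s x) y)) \<le> norm y * (M * norm x * t)" for y
    proof -
      have "norm (integral {0..t} (\<lambda>s. inner (S s x) y)) \<le> (M * norm x * norm y) * (t - 0)"
      proof (rule integral_bound)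
        fix s assume "s \<in> {0..t}"
        then have "norm (S s x) * norm y \<le> M * norm x * norm y" by (intro mult_right_mono M) auto
        then show "norm (inner (S s x) y) \<le> M * norm x * norm y"
          using Cauchy_Schwarz_ineq2[of "S s x" y] by simp
      qed (auto intro: t continuous_on_inner_S)
      then show ?thesis by (simp add: mult_ac)
    qed
  qed
  then obtain v where "\<And>y. integral {0..t} (\<lambda>s. inner (S s x) y) = inner y v"
    using Riesz_representation by metis
  then have "\<exists>v. \<forall>y. inner v y = integral {0..t} (\<lambda>s. inner (S s x) y)"
    by (metis inner_commute)
  from someI_ex[OF this] show ?thesis unfolding I_def by blast
qed

text \<open>Used with z = 0 to bound \<open>I t\<close>, and with z = x to see that the averages of
  an orbit over short intervals tend to x.\<close>

lemma norm_I_diff_le: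
  assumes t: "t \<ge> 0" and K: "\<And>s. 0 \<le> s \<Longrightarrow> s \<le> t \<Longrightarrow> norm (S s x - z) \<le> K"
  shows "norm (I t x - t *\<^sub>R z) \<le> t * K"
proof (rule norm_le_of_inner_le)
  have "0 \<le> K" using K[of 0] t by (meson norm_ge_zero order_trans order_refl)
  then show "0 \<le> t * K" using t by simp
  fix y
  have "inner y (I t x - t *\<^sub>R z) = integral {0..t} (\<lambda>s. inner (S s x) y) - integral {0..t} (\<lambda>s. inner z y)"
    using inner_I[OF t, of x y] t by (simp add: inner_diff_right inner_commute)
  also have "\<dots> = integral {0..t} (\<lambda>s. inner (S s x - z) y)"
    unfolding inner_diff_left by (rule integral_diff[symmetric]) (auto intro: integrable_inner_S)
  also have "\<dots> \<le> norm (integral {0..t} (\<lambda>s. inner (S s x - z) y))" by simp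
  also have "\<dots> \<le> (K * norm y) * (t - 0)"
  proof (rule integral_bound)
    show "continuous_on {0..t} (\<lambda>s. inner (S s x - z) y)"
      unfolding inner_diff_left by (intro continuous_intros) auto
    fix s assume "s \<in> {0..t}"
    then have "norm (S s x - z) * norm y \<le> K * norm y" by (intro mult_right_mono K) auto
    then show "norm (inner (S s x - z) y) \<le> K * norm y"
      using Cauchy_Schwarz_ineq2[of "S s x - z" y] by simp
  qed (use t in simp)
  finally show "inner y (I t x - t *\<^sub>R z) \<le> t * K * norm y" by (simp add: mult_ac)
qed

lemma norm_I_le:
  assumes "t \<ge> 0" "\<And>s x. 0 \<le> s \<Longrightarrow> s \<le> t \<Longrightarrow> norm (S s x) \<le> M * norm x"
  shows "norm (I t x) \<le> t * M * norm x"
  using norm_I_diff_le[of t x 0 "M * norm x"] assms by (simp add: mult_ac)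

lemma bounded_linear_I:
  assumes t: "t \<ge> 0"
  shows "bounded_linear (I t)"
proof -
  obtain M where M: "M \<ge> 1" "\<And>s x. 0 \<le> s \<Longrightarrow> s \<le> t \<Longrightarrow> norm (S s x) \<le> M * norm x"
    using S_bounded[of t] by blast
  show ?thesis
  proof (rule bounded_linear_intro)
    show "I t (x + y) = I t x + I t y" for x y
    proof (rule vector_eq_rdot[THEN iffD1], intro allI)
      fix z
      have "integral {0..t} (\<lambda>s. inner (S s (x + y)) z) =
          integral {0..t} (\<lambda>s. inner (S s x) z + inner (S s y) z)"
        by (intro integral_cong) (simp add: S_linear inner_add_left)
      then show "inner (I t (x + y)) z = inner (I t x + I t y) z"
        by (simp add: inner_I[OF t] inner_add_left integral_add integrable_inner_S)
    qed
    show "I t (r *\<^sub>R x) = r *\<^sub>R I t x" for r x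
    proof (rule vector_eq_rdot[THEN iffD1], intro allI)
      fix z
      have "integral {0..t} (\<lambda>s. inner (S s (r *\<^sub>R x)) z) = integral {0..t} (\<lambda>s. r * inner (S s x) z)"
        by (intro integral_cong) (simp add: S_linear)
      then show "inner (I t (r *\<^sub>R x)) z = inner (r *\<^sub>R I t x) z"
        by (simp add: inner_I[OF t])
    qed
    show "norm (I t x) \<le> norm x * (t * M)" for x
      using norm_I_le[OF t M(2), of x] by (simp add: mult_ac)
  qed
qed

text \<open>The integral is weak, so \<open>S h\<close> is pulled out by moving it to the test
  vector as an adjoint and back.\<close>

lemma I_S_commute:
  assumes "t \<ge> 0" "h \<ge> 0"
  shows "I t (S h x) = S h (I t x)"
proof (rule vector_eq_rdot[THEN iffD1], intro allI)
  fix z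
  have "integral {0..t} (\<lambda>s. inner (S s (S h x)) z) =
      integral {0..t} (\<lambda>s. inner (S s x) (adjoint (S h) z))"
  proof (rule integral_cong)
    fix s assume "s \<in> {0..t}"
    then have "S s (S h x) = S h (S s x)"
      using S_add[of s h x] S_add[of h s x] assms by (simp add: add.commute)
    then show "inner (S s (S h x)) z = inner (S s x) (adjoint (S h) z)"
      by (simp add: adjoint_inner[OF bounded_linear_S] assms)
  qed
  then show "inner (I t (S h x)) z = inner (S h (I t x)) z"
    by (simp add: adjoint_inner[OF bounded_linear_S] inner_I assms)
qed

text \<open>Substituting s + h moves the interval to [h, h + t]. The first term on the right is
  symmetric in h and t, which \<open>S_I_diff\<close> exploits.\<close>

lemma inner_I_S_shift:
  assumes "t \<ge> 0" "h \<ge> 0"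
  shows "inner (I t (S h x)) z = integral {0..h + t} (\<lambda>s. inner (S s x) z) - inner (I h x) z"
proof -
  define g where "g = (\<lambda>s. inner (S s x) z)"
  have "integral {0..t} (\<lambda>s. inner (S s (S h x)) z) = integral {0..t} (g \<circ> (\<lambda>s. s + h))"
    by (intro integral_cong) (simp add: g_def S_add assms)
  also have "\<dots> = integral {0 + h..t + h} g"
    by (rule integral_shift) (use assms in \<open>auto simp: g_def intro!: continuous_on_inner_S\<close>)
  also have "\<dots> = integral {0..h + t} g - integral {0..h} g"
    unfolding g_def
    using Henstock_Kurzweil_Integration.integral_combine[of 0 h "h + t" "\<lambda>s. inner (S s x) z"] assms
    by (simp add: integrable_inner_S add.commute)
  finally show ?thesis by (simp add: inner_I assms g_def)
qed

text \<open>Tested against z, both sides are the integral over [0, h + t] minus the contributions of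
  \<open>I h x\<close> and \<open>I t x\<close>. Division by h and passage to 0 give both
  \<open>I_in_D\<close> and \<open>I_A\<close>.\<close>

lemma S_I_diff:
  assumes "t \<ge> 0" "h \<ge> 0"
  shows "S h (I t x) - I t x = I h (S t x - x)"
proof (rule vector_eq_rdot[THEN iffD1], intro allI)
  fix z
  have "I h (S t x - x) = I h (S t x) - I h x"
    using bounded_linear_I[OF assms(2)] by (simp add: bounded_linear.linear linear_diff)
  then show "inner (S h (I t x) - I t x) z = inner (I h (S t x - x)) z"
    using inner_I_S_shift[OF assms, of x z] inner_I_S_shift[OF assms(2,1), of x z] assms
    by (simp add: inner_diff_left I_S_commute[symmetric] add.commute)
qed

lemma I_tendsto: "((\<lambda>h. I h x /\<^sub>R h) \<longlongrightarrow> x) (at_right 0)"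
proof (rule tendstoI)
  fix e :: real assume e: "e > 0"
  have "\<forall>\<^sub>F h in at_right 0. dist (S h x) x < e / 2"
    by (rule tendstoD[OF S_tendsto]) (use e in simp)
  then obtain d where d: "d > 0" "\<And>h. 0 < h \<Longrightarrow> h < d \<Longrightarrow> dist (S h x) x < e / 2"
    unfolding eventually_at_right_field by auto
  show "\<forall>\<^sub>F h in at_right 0. dist (I h x /\<^sub>R h) x < e"
    unfolding eventually_at_right_field
  proof (intro exI conjI allI impI)
    show "d > 0" by (rule d)
    fix h assume h: "0 < h" "h < d"
    have "norm (I h x - h *\<^sub>R x) \<le> h * (e / 2)"
    proof (rule norm_I_diff_le)
      fix s assume "0 \<le> s" "s \<le> h"
      then show "norm (S s x - x) \<le> e / 2"
        using d(2)[of s] e h by (cases "s = 0") (auto simp: dist_norm)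
    qed (use h in simp)
    moreover from h have "I h x /\<^sub>R h - x = (I h x - h *\<^sub>R x) /\<^sub>R h" by (simp add: scaleR_diff_right)
    then have "norm (I h x /\<^sub>R h - x) = norm (I h x - h *\<^sub>R x) / h"
      using h by (simp add: divide_inverse mult.commute)
    ultimately have "norm (I h x /\<^sub>R h - x) \<le> e / 2" using h by (simp add: pos_divide_le_eq mult.commute)
    then show "dist (I h x /\<^sub>R h) x < e" using e by (simp add: dist_norm)
  qed
qed

lemma I_in_D:
  assumes "t \<ge> 0"
  shows "I t x \<in> D" "A (I t x) = S t x - x"
proof -
  have "((\<lambda>h. (S h (I t x) - I t x) /\<^sub>R h) \<longlongrightarrow> S t x - x) (at_right 0)"
  proof (rule Lim_transform_eventually[OF I_tendsto])
    show "\<forall>\<^sub>F h in at_right 0. I h (S t x - x) /\<^sub>R h = (S h (I t x) - I t x) /\<^sub>R h"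
      using eventually_at_right_less[of 0] by eventually_elim (simp add: S_I_diff assms)
  qed
  from D_I[OF this] show "I t x \<in> D" "A (I t x) = S t x - x" .
qed

text \<open>Density of \<open>D\<close> in the form needed for uniqueness of the adjoint:
  \<open>I h x\<close> lies in \<open>D\<close>, and \<open>I h x /\<^sub>R h\<close> tends to
  x.\<close>

lemma inner_D_cancel:
  assumes "\<And>x. x \<in> D \<Longrightarrow> inner x v = inner x w"
  shows "v = w"
proof -
  have "((\<lambda>h. inner (I h x /\<^sub>R h) v) \<longlongrightarrow> inner x v) (at_right 0)" for x v
    by (intro tendsto_intros I_tendsto)
  moreover have "((\<lambda>h. inner (I h x /\<^sub>R h) v) \<longlongrightarrow> inner x w) (at_right 0)" for x
  proof (rule Lim_transform_eventually)
    show "((\<lambda>h. inner (I h x /\<^sub>R h) w) \<longlongrightarrow> inner x w) (at_right 0)"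
      by (intro tendsto_intros I_tendsto)
    show "\<forall>\<^sub>F h in at_right 0. inner (I h x /\<^sub>R h) w = inner (I h x /\<^sub>R h) v"
      using eventually_at_right_less[of 0]
      by eventually_elim (use assms I_in_D(1) in simp)
  qed
  ultimately have "inner x v = inner x w" for x
    by (rule tendsto_unique[OF trivial_limit_at_right_real])
  then show ?thesis using vector_eq_ldot by blast
qed

section \<open>The adjoint of the generator, and orbits inside the domain\<close>

lemma adj_op_eqI:
  assumes "\<And>x. x \<in> D \<Longrightarrow> inner (A x) y = inner x z"
  shows "y \<in> adj_dom D A" "adj_op D A y = z"
proof -
  show "y \<in> adj_dom D A" using assms unfolding adj_dom_def by blast
  show "adj_op D A y = z" unfolding adj_op_def
  proof (rule the_equality)
    show "w = z" if "\<forall>x\<in>D. inner (A x) y = inner x w" for w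
      by (rule inner_D_cancel) (use that assms in simp)
  qed (use assms in blast)
qed

lemma inner_adj_op: "y \<in> adj_dom D A \<Longrightarrow> x \<in> D \<Longrightarrow> inner (A x) y = inner x (adj_op D A y)"
proof -
  assume y: "y \<in> adj_dom D A" and x: "x \<in> D"
  then obtain z where z: "\<And>x. x \<in> D \<Longrightarrow> inner (A x) y = inner x z" unfolding adj_dom_def by blast
  show ?thesis using adj_op_eqI(2)[OF z] z x by simp
qed

lemma adj_op_zero [simp]: "0 \<in> adj_dom D A" "adj_op D A 0 = 0"
  using adj_op_eqI[of 0 0] by auto

lemma adj_op_add:
  assumes "x \<in> adj_dom D A" "y \<in> adj_dom D A"
  shows "x + y \<in> adj_dom D A" "adj_op D A (x + y) = adj_op D A x + adj_op D A y"
  using adj_op_eqI[of "x + y" "adj_op D A x + adj_op D A y"] inner_adj_op assms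
  by (auto simp: inner_add_right)

lemma adj_op_scaleR:
  assumes "x \<in> adj_dom D A"
  shows "r *\<^sub>R x \<in> adj_dom D A" "adj_op D A (r *\<^sub>R x) = r *\<^sub>R adj_op D A x"
  using adj_op_eqI[of "r *\<^sub>R x" "r *\<^sub>R adj_op D A x"] inner_adj_op assms by auto

lemma adj_op_diff:
  assumes "x \<in> adj_dom D A" "y \<in> adj_dom D A"
  shows "x - y \<in> adj_dom D A" "adj_op D A (x - y) = adj_op D A x - adj_op D A y"
  using adj_op_eqI[of "x - y" "adj_op D A x - adj_op D A y"] inner_adj_op assms
  by (auto simp: inner_diff_right)

lemma subspace_adj_dom: "subspace (adj_dom D A)"
  unfolding subspace_def using adj_op_add adj_op_scaleR by auto

lemma S_in_D:
  assumes "x \<in> D" "t \<ge> 0"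
  shows "S t x \<in> D" "A (S t x) = S t (A x)"
proof -
  have "((\<lambda>h. (S h (S t x) - S t x) /\<^sub>R h) \<longlongrightarrow> S t (A x)) (at_right 0)"
  proof (rule Lim_transform_eventually[OF bounded_linear.tendsto[OF bounded_linear_S[OF assms(2)] A_tendsto[OF assms(1)]]])
    show "\<forall>\<^sub>F h in at_right 0. S t ((S h x - x) /\<^sub>R h) = (S h (S t x) - S t x) /\<^sub>R h"
      using eventually_at_right_less[of 0]
    proof eventually_elim
      case (elim h)
      have "S t (S h x) = S h (S t x)"
        using S_add[of t h x] S_add[of h t x] assms elim by (simp add: add.commute)
      then show ?case using assms by (simp add: S_linear)
    qed
  qed
  from D_I[OF this] show "S t x \<in> D" "A (S t x) = S t (A x)" .
qed

text \<open>By \<open>S_I_diff\<close>, \<open>I t\<close> of the difference quotient of x equals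
  the average \<open>I h (S t x - x) /\<^sub>R h\<close>; the two limits are the two sides.\<close>

lemma I_A:
  assumes "x \<in> D" "t \<ge> 0"
  shows "I t (A x) = S t x - x"
proof (rule tendsto_unique)
  show "((\<lambda>h. I t ((S h x - x) /\<^sub>R h)) \<longlongrightarrow> I t (A x)) (at_right 0)"
    by (rule bounded_linear.tendsto[OF bounded_linear_I[OF assms(2)] A_tendsto[OF assms(1)]])
  show "((\<lambda>h. I t ((S h x - x) /\<^sub>R h)) \<longlongrightarrow> S t x - x) (at_right 0)"
  proof (rule Lim_transform_eventually[OF I_tendsto])
    show "\<forall>\<^sub>F h in at_right 0. I h (S t x - x) /\<^sub>R h = I t ((S h x - x) /\<^sub>R h)"
      using eventually_at_right_less[of 0]
    proof eventually_elim
      case (elim h)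
      then show ?case
        using assms bounded_linear.linear[OF bounded_linear_I[OF assms(2)]]
        by (simp add: S_I_diff[symmetric] I_S_commute linear_diff linear_scale)
    qed
  qed
qed simp

section \<open>The adjoint semigroup and the adjoint of the integral\<close>

abbreviation S' :: "real \<Rightarrow> 'h \<Rightarrow> 'h" where "S' t \<equiv> adjoint (S t)"
abbreviation I' :: "real \<Rightarrow> 'h \<Rightarrow> 'h" where "I' t \<equiv> adjoint (I t)"

lemma inner_S': "t \<ge> 0 \<Longrightarrow> inner x (S' t y) = inner (S t x) y"
  by (simp add: adjoint_inner bounded_linear_S)

lemma inner_I': "t \<ge> 0 \<Longrightarrow> inner x (I' t y) = inner (I t x) y"
  by (simp add: adjoint_inner bounded_linear_I)

text \<open>Transpose of \<open>I_A\<close>. It provides, for arbitrary y, admissible test vectors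
  on which \<open>A'\<close> is explicit.\<close>

lemma I'_in_adj_dom:
  assumes "t \<ge> 0"
  shows "I' t y \<in> adj_dom D A" "adj_op D A (I' t y) = S' t y - y"
proof -
  have "inner (A x) (I' t y) = inner x (S' t y - y)" if "x \<in> D" for x
    using that assms by (simp add: inner_I' I_A inner_diff_right inner_diff_left inner_S')
  from adj_op_eqI[OF this] show "I' t y \<in> adj_dom D A" "adj_op D A (I' t y) = S' t y - y" by auto
qed

lemma S'_in_adj_dom:
  assumes "y \<in> adj_dom D A" "t \<ge> 0"
  shows "S' t y \<in> adj_dom D A" "adj_op D A (S' t y) = S' t (adj_op D A y)"
proof -
  have "inner (A x) (S' t y) = inner x (S' t (adj_op D A y))" if "x \<in> D" for x
    using that assms inner_adj_op[OF assms(1) S_in_D(1)] by (simp add: inner_S' S_in_D)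
  from adj_op_eqI[OF this] show "S' t y \<in> adj_dom D A" "adj_op D A (S' t y) = S' t (adj_op D A y)"
    by auto
qed

text \<open>Transpose of \<open>I_in_D\<close>: \<open>I t x\<close> is in \<open>D\<close> for
  every x, so y can be paired with \<open>A (I t x)\<close>.\<close>

lemma S'_diff:
  assumes "y \<in> adj_dom D A" "t \<ge> 0"
  shows "S' t y - y = I' t (adj_op D A y)"
proof (rule vector_eq_ldot[THEN iffD1], intro allI)
  fix x
  show "inner x (S' t y - y) = inner x (I' t (adj_op D A y))"
    using inner_adj_op[OF assms(1) I_in_D(1)[OF assms(2)], of x] assms
    by (simp add: inner_I' inner_diff_right inner_diff_left inner_S' I_in_D(2))
qed

lemma S'_zero [simp]: "S' 0 y = y"
  by (rule vector_eq_ldot[THEN iffD1]) (simp add: inner_S')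

lemma S'_add: "s \<ge> 0 \<Longrightarrow> t \<ge> 0 \<Longrightarrow> S' (s + t) y = S' s (S' t y)"
  by (rule vector_eq_ldot[THEN iffD1]) (simp add: inner_S' S_add[of t s, symmetric] add.commute[of t])

lemma S'_linear:
  assumes "t \<ge> 0"
  shows "S' t (x + y) = S' t x + S' t y" "S' t (x - y) = S' t x - S' t y"
    "S' t (r *\<^sub>R x) = r *\<^sub>R S' t x"
proof -
  interpret bounded_linear "S' t" by (rule bounded_linear_adjoint[OF bounded_linear_S[OF assms]])
  show "S' t (x + y) = S' t x + S' t y" "S' t (x - y) = S' t x - S' t y"
    "S' t (r *\<^sub>R x) = r *\<^sub>R S' t x"
    by (rule add diff scaleR)+
qed

lemma S'_bounded:
  obtains M where "M \<ge> 1" "\<And>t x. 0 \<le> t \<Longrightarrow> t \<le> T \<Longrightarrow> norm (S t x) \<le> M * norm x"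
    "\<And>t x. 0 \<le> t \<Longrightarrow> t \<le> T \<Longrightarrow> norm (S' t x) \<le> M * norm x"
    "\<And>t x. 0 \<le> t \<Longrightarrow> t \<le> T \<Longrightarrow> norm (I' t x) \<le> t * M * norm x"
proof -
  obtain M where M: "M \<ge> 1" "\<And>s x. 0 \<le> s \<Longrightarrow> s \<le> T \<Longrightarrow> norm (S s x) \<le> M * norm x"
    using S_bounded[of T] by blast
  show thesis
  proof (rule that[OF M])
    fix t x assume t: "0 \<le> t" "t \<le> T"
    show "norm (S' t x) \<le> M * norm x"
      by (rule norm_adjoint_le[OF bounded_linear_S]) (use t M in auto)
    show "norm (I' t x) \<le> t * M * norm x"
      by (rule norm_adjoint_le[OF bounded_linear_I]) (use t M norm_I_le[of t M] in auto)
  qed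
qed

text \<open>The residual of y after projection onto the closure is orthogonal to every
  \<open>I' t x\<close>, hence is killed by every \<open>I t\<close>; being the limit of its own
  averages, it vanishes.\<close>

lemma adj_dom_dense:
  obtains X where "\<And>n::nat. X n \<in> adj_dom D A" "X \<longlonglongrightarrow> y"
proof -
  have "subspace (closure (adj_dom D A))" by (rule closure_subspace_is_subspace[OF subspace_adj_dom])
  then obtain p where p: "p \<in> closure (adj_dom D A)"
    "\<And>q. q \<in> closure (adj_dom D A) \<Longrightarrow> inner (y - p) q = 0"
    using complete_subspace_orthogonal_projection[of "closure (adj_dom D A)" y] by auto
  have I0: "I t (y - p) = 0" if "t \<ge> 0" for t
  proof (rule vector_eq_rdot[THEN iffD1], intro allI)
    fix x
    have "I' t x \<in> closure (adj_dom D A)" using I'_in_adj_dom(1)[OF that] closure_subset by blast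
    then show "inner (I t (y - p)) x = inner 0 x"
      using p(2) inner_I'[OF that, of "y - p" x] by simp
  qed
  have "((\<lambda>h. I h (y - p) /\<^sub>R h) \<longlongrightarrow> 0) (at_right 0)"
  proof (rule Lim_transform_eventually[OF tendsto_const])
    show "\<forall>\<^sub>F h in at_right 0. 0 = I h (y - p) /\<^sub>R h"
      using eventually_at_right_less[of 0] by eventually_elim (simp add: I0)
  qed
  then have "y - p = 0" using tendsto_unique[OF _ I_tendsto] by force
  then have "y \<in> closure (adj_dom D A)" using p(1) by simp
  then show thesis using that closure_sequential by blast
qed

text \<open>Transposition alone gives only weak continuity. Orbits starting in the domain of
  \<open>A'\<close> are Lipschitz by \<open>S'_diff\<close>, and density together with the bound
  \<open>M\<close> makes every other orbit a uniform limit of these.\<close>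

lemma continuous_on_S': "continuous_on {0..T} (\<lambda>t. S' t y)"
proof -
  obtain M where M: "M \<ge> 1" "\<And>t x. 0 \<le> t \<Longrightarrow> t \<le> T \<Longrightarrow> norm (S' t x) \<le> M * norm x"
    "\<And>t x. 0 \<le> t \<Longrightarrow> t \<le> T \<Longrightarrow> norm (I' t x) \<le> t * M * norm x"
    using S'_bounded[of T] by metis
  have lip: "norm (S' t x - S' s x) \<le> M * (M * norm (adj_op D A x)) * (t - s)"
    if "x \<in> adj_dom D A" "0 \<le> s" "s \<le> t" "t \<le> T" for s t x
  proof -
    have "S' t x - S' s x = S' s (I' (t - s) (adj_op D A x))"
      using that S'_diff[OF that(1), of "t - s"] S'_add[of s "t - s" x] S'_linear(2)[of s]
      by (metis add_diff_cancel_left' diff_add_cancel diff_ge_0_iff_ge add.commute)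
    also have "norm \<dots> \<le> M * norm (I' (t - s) (adj_op D A x))" using that by (intro M) auto
    also have "\<dots> \<le> M * ((t - s) * M * norm (adj_op D A x))"
      using that M(1) by (intro mult_left_mono M) auto
    finally show ?thesis by (simp add: mult_ac)
  qed
  have cont: "continuous_on {0..T} (\<lambda>t. S' t x)" if x: "x \<in> adj_dom D A" for x
  proof (rule lipschitz_on_continuous_on)
    show "(M * (M * norm (adj_op D A x)))-lipschitz_on {0..T} (\<lambda>t. S' t x)"
    proof (rule lipschitz_onI)
      fix s t assume "s \<in> {0..T}" "t \<in> {0..T}"
      then show "dist (S' s x) (S' t x) \<le> M * (M * norm (adj_op D A x)) * dist s t"
        using lip[OF x, of s t] lip[OF x, of t s]
        by (cases "s \<le> t") (auto simp: dist_norm norm_minus_commute dist_real_def)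
    qed (use M in simp)
  qed
  obtain X where X: "\<And>n::nat. X n \<in> adj_dom D A" "X \<longlonglongrightarrow> y" using adj_dom_dense by blast
  show ?thesis
  proof (rule uniform_limit_theorem)
    show "uniform_limit {0..T} (\<lambda>n t. S' t (X n)) (\<lambda>t. S' t y) sequentially"
      unfolding uniform_limit_iff
    proof (intro allI impI)
      fix e :: real assume "e > 0"
      then have "\<forall>\<^sub>F n in sequentially. dist (X n) y < e / M"
        using M(1) by (intro tendstoD[OF X(2)]) auto
      then show "\<forall>\<^sub>F n in sequentially. \<forall>t\<in>{0..T}. dist (S' t (X n)) (S' t y) < e"
      proof eventually_elim
        case (elim n)
        have "dist (S' t (X n)) (S' t y) < e" if "t \<in> {0..T}" for t
        proof -
          have "dist (S' t (X n)) (S' t y) \<le> M * norm (X n - y)"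
            using M(2)[of t "X n - y"] that by (simp add: dist_norm S'_linear)
          also have "\<dots> < M * (e / M)"
            using elim M(1) by (intro mult_strict_left_mono) (auto simp: dist_norm)
          finally show ?thesis using M(1) by simp
        qed
        then show ?case by blast
      qed
    qed
  qed (use cont X in auto)
qed

end

section \<open>Control operators, steady pairs and the minimisation problem\<close>

locale control_system = c0_semigroup D A S
  for D :: "'h::{real_inner, complete_space} set" and A S +
  fixes B :: "'u::{real_inner, complete_space} \<Rightarrow> 'h \<Rightarrow> real"
  assumes control_operator: "control_operator D A B"
begin

abbreviation A' :: "'h \<Rightarrow> 'h" where "A' \<equiv> adj_op D A"
abbreviation B' :: "'h \<Rightarrow> 'u" where "B' \<equiv> control_adj B"

lemma adj_graph_norm_le: "adj_graph_norm D A y \<le> norm y + norm (A' y)"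
  unfolding adj_graph_norm_def by (rule real_le_lsqrt) (auto simp: power2_sum)

lemma B_bounded:
  obtains K where "K \<ge> 0" "\<And>u y. y \<in> adj_dom D A \<Longrightarrow> \<bar>B u y\<bar> \<le> norm u * (K * (norm y + norm (A' y)))"
proof -
  obtain K where K: "K \<ge> 0" "\<And>u y. y \<in> adj_dom D A \<Longrightarrow> \<bar>B u y\<bar> \<le> K * norm u * adj_graph_norm D A y"
    using control_operator unfolding control_operator_def by blast
  have "\<bar>B u y\<bar> \<le> norm u * (K * (norm y + norm (A' y)))" if "y \<in> adj_dom D A" for u y
    using order_trans[OF K(2)[OF that] mult_left_mono[OF adj_graph_norm_le]] K(1)
    by (simp add: mult_ac)
  then show thesis using that K(1) by blast
qed

lemma inner_control_adj:
  assumes y: "y \<in> adj_dom D A"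
  shows "inner u (B' y) = B u y"
proof -
  obtain K where K: "\<And>u. \<bar>B u y\<bar> \<le> norm u * (K * (norm y + norm (A' y)))"
    using B_bounded y by metis
  have "bounded_linear (\<lambda>u. B u y)"
    by (rule bounded_linear_intro[where K = "K * (norm y + norm (A' y))"])
      (use control_operator y K in \<open>auto simp: control_operator_def\<close>)
  then obtain v where v: "\<And>u. B u y = inner u v" using Riesz_representation by metis
  have "B' y = v" unfolding control_adj_def
  proof (rule the_equality)
    show "w = v" if "\<forall>u. inner u w = B u y" for w
      using that v by (intro vector_eq_ldot[THEN iffD1]) simp
  qed (use v in simp)
  then show ?thesis using v by simp
qed

lemma control_adj_linear:
  assumes "x \<in> adj_dom D A" "y \<in> adj_dom D A"
  shows "B' (x + y) = B' x + B' y" "B' (x - y) = B' x - B' y" "B' (r *\<^sub>R x) = r *\<^sub>R B' x" "B' 0 = 0"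
proof -
  have add: "B u (x + y) = B u x + B u y" and sc: "B u (r *\<^sub>R x) = r * B u x"
    if "x \<in> adj_dom D A" "y \<in> adj_dom D A" for u x y r
    using control_operator that unfolding control_operator_def adj_dom_dual_def by blast+
  have sum: "B' (x + y) = B' x + B' y" if "x \<in> adj_dom D A" "y \<in> adj_dom D A" for x y
    by (rule vector_eq_ldot[THEN iffD1])
      (simp add: inner_control_adj inner_add_right adj_op_add that add)
  have scale: "B' (r *\<^sub>R x) = r *\<^sub>R B' x" if "x \<in> adj_dom D A" for x r
    by (rule vector_eq_ldot[THEN iffD1])
      (simp add: inner_control_adj adj_op_scaleR that sc[OF that that])
  show "B' (x + y) = B' x + B' y" "B' (r *\<^sub>R x) = r *\<^sub>R B' x"
    by (rule sum[OF assms] scale[OF assms(1)])+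
  show "B' (x - y) = B' x - B' y"
    using sum[OF assms(1) adj_op_scaleR(1)[OF assms(2)], of "-1"] scale[OF assms(2), of "-1"] by simp
  show "B' 0 = 0" using scale[of 0 0] by simp
qed

lemma norm_control_adj_le:
  obtains K where "K \<ge> 0" "\<And>y. y \<in> adj_dom D A \<Longrightarrow> norm (B' y) \<le> K * (norm y + norm (A' y))"
proof -
  obtain K where K: "K \<ge> 0" "\<And>u y. y \<in> adj_dom D A \<Longrightarrow> \<bar>B u y\<bar> \<le> norm u * (K * (norm y + norm (A' y)))"
    using B_bounded by blast
  have "norm (B' y) \<le> K * (norm y + norm (A' y))" if y: "y \<in> adj_dom D A" for y
  proof (rule norm_le_of_inner_le)
    show "inner u (B' y) \<le> K * (norm y + norm (A' y)) * norm u" for u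
      using K(2)[OF y, of u] inner_control_adj[OF y, of u] by (simp add: mult_ac)
  qed (use K in simp)
  then show thesis using that K(1) by blast
qed

text \<open>Integration in time buys the regularity that \<open>B'\<close> demands: the
  \<open>A'\<close> part of the graph norm of \<open>I' t y\<close> is the norm of
  \<open>S' t y - y\<close>. Both coercivity estimates rest on this bound.\<close>

lemma norm_control_adj_I'_le:
  assumes "T \<ge> 0"
  obtains L where "L \<ge> 0" "\<And>t y. 0 \<le> t \<Longrightarrow> t \<le> T \<Longrightarrow> norm (B' (I' t y)) \<le> L * norm y"
proof -
  obtain M where M: "M \<ge> 1" "\<And>t x. 0 \<le> t \<Longrightarrow> t \<le> T \<Longrightarrow> norm (S' t x) \<le> M * norm x"
    "\<And>t x. 0 \<le> t \<Longrightarrow> t \<le> T \<Longrightarrow> norm (I' t x) \<le> t * M * norm x"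
    using S'_bounded[of T] by metis
  obtain K where K: "K \<ge> 0" "\<And>y. y \<in> adj_dom D A \<Longrightarrow> norm (B' y) \<le> K * (norm y + norm (A' y))"
    using norm_control_adj_le by blast
  show thesis
  proof (rule that)
    \<comment> \<open>\<open>T * M\<close> bounds \<open>I' t\<close>, and \<open>M + 1\<close>
      bounds \<open>S' t\<close> minus the identity.\<close>
    show "K * (T * M + (M + 1)) \<ge> 0" using K M assms by simp
    fix t y assume t: "0 \<le> t" "t \<le> T"
    have "norm (B' (I' t y)) \<le> K * (norm (I' t y) + norm (S' t y - y))"
      using K(2)[OF I'_in_adj_dom(1)] t by (simp add: I'_in_adj_dom(2))
    also have "\<dots> \<le> K * (T * M * norm y + (M * norm y + norm y))"
    proof (intro mult_left_mono add_mono K(1))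
      have "t * M * norm y \<le> T * M * norm y" using t M(1) by (intro mult_right_mono) auto
      then show "norm (I' t y) \<le> T * M * norm y" using M(3)[OF t, of y] by linarith
      show "norm (S' t y - y) \<le> M * norm y + norm y"
        using M(2)[OF t, of y] norm_triangle_ineq4[of "S' t y" y] by linarith
    qed
    finally show "norm (B' (I' t y)) \<le> K * (T * M + (M + 1)) * norm y" by (simp add: algebra_simps)
  qed
qed

lemma steady_pairs_iff:
  "(x, u) \<in> steady_pairs D A B \<longleftrightarrow> (\<forall>y\<in>adj_dom D A. inner (x, u) (A' y, B' y) = 0)"
  by (simp add: steady_pairs_def inner_prod_def)

lemma subspace_steady_pairs: "subspace (steady_pairs D A B)"
  and closed_steady_pairs: "closed (steady_pairs D A B)"
proof -
  have eq: "steady_pairs D A B = (\<Inter>y\<in>adj_dom D A. {p. inner p (A' y, B' y) = 0})"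
    using steady_pairs_iff by auto
  show "closed (steady_pairs D A B)" unfolding eq
    by (intro closed_INT ballI closed_Collect_eq continuous_intros)
  show "subspace (steady_pairs D A B)" unfolding eq subspace_def
    by (auto simp: inner_add_left simp del: inner_Pair)
qed

text \<open>A steady pair satisfies S t x + \<integral> S (t - s) B u ds = x, and the integral of a constant control
  is bounded by the norm of u, because I' t maps the space continuously into the domain of the
  adjoint.\<close>

lemma steady_pair_drift_le:
  assumes "T \<ge> 0"
  obtains L where "L \<ge> 0" "\<And>x u t. (x, u) \<in> steady_pairs D A B \<Longrightarrow> 0 \<le> t \<Longrightarrow> t \<le> T \<Longrightarrow>
    norm (S t x - x) \<le> L * norm u"
proof -
  obtain L where L: "L \<ge> 0" "\<And>t y. 0 \<le> t \<Longrightarrow> t \<le> T \<Longrightarrow> norm (B' (I' t y)) \<le> L * norm y"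
    using norm_control_adj_I'_le[OF assms] by blast
  have "norm (S t x - x) \<le> L * norm u"
    if p: "(x, u) \<in> steady_pairs D A B" and t: "0 \<le> t" "t \<le> T" for x u t
  proof (rule norm_le_of_inner_le)
    fix y
    have "inner y (S t x - x) = inner x (A' (I' t y))"
      using t by (simp add: I'_in_adj_dom inner_S' inner_diff_right inner_commute[of y])
    also have "\<dots> = - inner u (B' (I' t y))"
      using p I'_in_adj_dom(1)[OF t(1), of y] by (auto simp: steady_pairs_def)
    also have "\<dots> \<le> norm u * norm (B' (I' t y))"
      using Cauchy_Schwarz_ineq2[of u "B' (I' t y)"] by simp
    also have "\<dots> \<le> norm u * (L * norm y)" by (intro mult_left_mono L t) auto
    finally show "inner y (S t x - x) \<le> L * norm u * norm y" by (simp add: mult_ac)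
  qed (use L in simp)
  then show thesis using that L(1) by blast
qed

text \<open>Along the orbit, C (S t x) is C x plus C of the drift, so it is bounded by the norms of
  C x and u. Integrating its square controls S T x through \<open>obs\<close>, and the drift at time
  \<open>T\<close> leads back to x.\<close>

lemma steady_pairs_coercive:
  assumes C: "bounded_linear C" and T: "T > 0" and c: "c > 0"
    and obs: "\<And>x. (LINT t|lebesgue_on {0..T}. (norm (C (S t x)))\<^sup>2) \<ge> c * (norm (S T x))\<^sup>2"
  obtains K where "K > 0" "\<And>x u. (x, u) \<in> steady_pairs D A B \<Longrightarrow> norm (x, u) \<le> K * norm (C x, u)"
proof -
  obtain L where L: "L \<ge> 0" "\<And>x u t. (x, u) \<in> steady_pairs D A B \<Longrightarrow> 0 \<le> t \<Longrightarrow> t \<le> T \<Longrightarrow>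
    norm (S t x - x) \<le> L * norm u"
    using steady_pair_drift_le[of T] T by (metis less_imp_le)
  interpret C: bounded_linear C by fact
  obtain k where k: "k \<ge> 0" "\<And>x. norm (C x) \<le> norm x * k" using C.nonneg_bounded by blast
  \<comment> \<open>Dominates both coefficients that arise below: 1 for C x and \<open>k * L\<close>
    for u.\<close>
  define \<alpha> where "\<alpha> = 1 + k * L"
  have \<alpha>: "\<alpha> \<ge> 1" using k L by (simp add: \<alpha>_def)
  define K where "K = sqrt (T / c) * \<alpha> + sqrt (T / c) * \<alpha> + (L + 1)"
  have "norm (x, u) \<le> K * norm (C x, u)" if p: "(x, u) \<in> steady_pairs D A B" for x u
  proof -
    define R where "R = \<alpha> * (norm (C x) + norm u)"
    have R0: "R \<ge> 0" using \<alpha> by (simp add: R_def)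
    have le: "(norm (C (S t x)))\<^sup>2 \<le> R\<^sup>2" if t: "t \<in> {0..T}" for t
    proof (rule power_mono)
      have "C (S t x) = C x + C (S t x - x)" by (simp flip: C.add)
      then have "norm (C (S t x)) \<le> norm (C x) + norm (C (S t x - x))" by (metis norm_triangle_ineq)
      also have "norm (C (S t x - x)) \<le> norm (S t x - x) * k" by (rule k)
      also have "\<dots> \<le> L * norm u * k" using L(2)[OF p] t k by (intro mult_right_mono) auto
      finally have "norm (C (S t x)) \<le> 1 * norm (C x) + k * L * norm u" by (simp add: mult_ac)
      also have "\<dots> \<le> \<alpha> * norm (C x) + \<alpha> * norm u"
        using k L by (intro add_mono mult_right_mono) (auto simp: \<alpha>_def)
      finally show "norm (C (S t x)) \<le> R" by (simp add: R_def algebra_simps)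
    qed simp
    have "c * (norm (S T x))\<^sup>2 \<le> (LINT t|lebesgue_on {0..T}. (norm (C (S t x)))\<^sup>2)" by (rule obs)
    also have "\<dots> \<le> (LINT t|lebesgue_on {0..T}. R\<^sup>2)"
      \<comment> \<open>Only the constant bound has to be integrable: by convention a non-integrable
        function has integral 0, so the left-hand integrand needs no measurability proof.\<close>
      by (rule integral_mono') (use le in \<open>auto simp: space_restrict_space\<close>)
    also have "\<dots> = T * R\<^sup>2" using T by (simp add: measure_restrict_space)
    finally have "(norm (S T x))\<^sup>2 \<le> T / c * R\<^sup>2" using c by (simp add: field_simps)
    then have "sqrt ((norm (S T x))\<^sup>2) \<le> sqrt (T / c * R\<^sup>2)" by (rule real_sqrt_le_mono)
    also have "sqrt (T / c * R\<^sup>2) = sqrt (T / c) * R" using R0 by (subst real_sqrt_mult) simp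
    finally have "norm (S T x) \<le> sqrt (T / c) * R" by simp
    moreover have "norm x \<le> norm (S T x) + norm (S T x - x)"
      using norm_triangle_ineq4[of "S T x" "S T x - x"] by simp
    moreover have "norm (S T x - x) \<le> L * norm u" using L(2)[OF p] T by simp
    ultimately have "norm x \<le> sqrt (T / c) * R + L * norm u" by linarith
    then have "norm (x, u) \<le> sqrt (T / c) * R + L * norm u + norm u"
      using norm_Pair_le[of x u] by linarith
    also have "\<dots> = sqrt (T / c) * \<alpha> * norm (C x) + sqrt (T / c) * \<alpha> * norm u + (L + 1) * norm u"
      by (simp add: R_def algebra_simps)
    also have "\<dots> \<le> sqrt (T / c) * \<alpha> * norm (C x, u) + sqrt (T / c) * \<alpha> * norm (C x, u)
        + (L + 1) * norm (C x, u)"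
    proof -
      have "norm (C x) \<le> norm (C x, u)" "norm u \<le> norm (C x, u)"
        by (rule norm_fst_le norm_snd_le)+
      then show ?thesis using \<alpha> L(1) T c by (intro add_mono mult_left_mono) auto
    qed
    finally show ?thesis by (simp add: K_def algebra_simps)
  qed
  moreover have "K > 0" using \<alpha> L(1) T c unfolding K_def by (intro add_nonneg_pos) auto
  ultimately show thesis using that by blast
qed

definition outputs :: "('h \<Rightarrow> 'h) \<Rightarrow> 'h \<times> 'u \<Rightarrow> 'h \<times> 'u" where
  "outputs C = (\<lambda>(x, u). (C x, u))"

lemma cost_eq: "cost C z p = (norm ((z, 0) - outputs C p))\<^sup>2"
  by (cases p) (simp add: cost_def outputs_def norm_prod_def norm_minus_commute)

lemma bounded_linear_outputs: "bounded_linear C \<Longrightarrow> bounded_linear (outputs C)"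
  unfolding outputs_def case_prod_beta
  by (intro bounded_linear_Pair bounded_linear_snd bounded_linear_compose[OF _ bounded_linear_fst])

context
  fixes C :: "'h \<Rightarrow> 'h" and K :: real
  assumes C: "bounded_linear C" and K: "K > 0"
    and coercive: "\<forall>p\<in>steady_pairs D A B. norm p \<le> K * norm (outputs C p)"
begin

text \<open>The second part is the first-order optimality condition, from which the adjoint state is
  later produced.\<close>

lemma exists_unique_optimal_steady_pair:
  shows "\<exists>!p. optimal_steady_pair D A B C z p"
    and "optimal_steady_pair D A B C z p \<Longrightarrow> q \<in> steady_pairs D A B \<Longrightarrow>
      inner ((z, 0) - outputs C p) (outputs C q) = 0"
proof -
  let ?M = "steady_pairs D A B"
  interpret f: bounded_linear "outputs C" by (rule bounded_linear_outputs[OF C])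
  have "complete (outputs C ` ?M)"
  proof (rule complete_isometric_image)
    show "0 < 1 / K" using K by simp
    show "\<forall>p\<in>?M. 1 / K * norm p \<le> norm (outputs C p)"
      using coercive K by (auto simp: field_simps)
  qed (auto intro: subspace_steady_pairs f.bounded_linear_axioms
        simp: complete_eq_closed closed_steady_pairs)
  then have "closed (outputs C ` ?M)" by (simp add: complete_eq_closed)
  moreover have "subspace (outputs C ` ?M)"
    by (rule linear_subspace_image[OF f.linear_axioms subspace_steady_pairs])
  ultimately obtain r where r: "r \<in> outputs C ` ?M"
    "\<And>q. q \<in> outputs C ` ?M \<Longrightarrow> inner ((z, 0) - r) q = 0"
    using complete_subspace_orthogonal_projection[of "outputs C ` ?M" "(z, 0)"] by metis
  then obtain p0 where p0: "p0 \<in> ?M" "r = outputs C p0" by blast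
  \<comment> \<open>The cost of \<open>q\<close> exceeds the minimum by exactly this square, since
    the residual is orthogonal to the image. Minimality is immediate, and coercivity turns zero
    excess into \<open>q = p0\<close>.\<close>
  have pyth: "cost C z q = cost C z p0 + (norm (outputs C (p0 - q)))\<^sup>2" if q: "q \<in> ?M" for q
  proof -
    have "p0 - q \<in> ?M" by (rule subspace_diff[OF subspace_steady_pairs p0(1) q])
    then have "inner ((z, 0) - r) (outputs C (p0 - q)) = 0" by (intro r) auto
    moreover have "(z, 0) - outputs C q = ((z, 0) - r) + outputs C (p0 - q)"
      by (simp add: f.diff p0(2))
    ultimately show ?thesis
      by (simp only: cost_eq norm_add_Pythagorean orthogonal_def) (simp add: p0(2))
  qed
  have inf: "(INF q\<in>?M. cost C z q) = cost C z p0"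
  proof (rule cInf_eq_minimum)
    show "cost C z p0 \<in> cost C z ` ?M" using p0 by blast
    show "cost C z p0 \<le> v" if "v \<in> cost C z ` ?M" for v using that pyth by auto
  qed
  have eq: "optimal_steady_pair D A B C z q \<longleftrightarrow> q = p0" for q
  proof
    assume "optimal_steady_pair D A B C z q"
    then have q: "q \<in> ?M" "cost C z q = cost C z p0" by (auto simp: optimal_steady_pair_def inf)
    then have "outputs C (p0 - q) = 0" using pyth[OF q(1)] by simp
    then have "norm (p0 - q) \<le> K * 0"
      using bspec[OF coercive subspace_diff[OF subspace_steady_pairs p0(1) q(1)]] by simp
    then show "q = p0" by simp
  qed (auto simp: optimal_steady_pair_def inf p0)
  then show "\<exists>!p. optimal_steady_pair D A B C z p" by auto
  show "optimal_steady_pair D A B C z p \<Longrightarrow> q \<in> ?M \<Longrightarrow>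
      inner ((z, 0) - outputs C p) (outputs C q) = 0"
    using r(2) p0 eq by auto
qed

end

lemma adjoint_range_eq_annihilator:
  assumes K: "K > 0" "\<And>y. y \<in> adj_dom D A \<Longrightarrow> norm y \<le> K * norm (A' y, B' y)"
    and w: "\<And>p. p \<in> steady_pairs D A B \<Longrightarrow> inner p w = 0"
  obtains y where "y \<in> adj_dom D A" "w = (A' y, B' y)"
proof -
  define V where "V = (\<lambda>y. (y, A' y, B' y)) ` adj_dom D A"
  have subV: "subspace V" unfolding subspace_def
  proof (intro conjI ballI allI)
    show "0 \<in> V" using control_adj_linear(4)[of 0 0]
      by (auto simp: V_def zero_prod_def intro!: image_eqI[of _ _ 0])
  next
    fix p q assume "p \<in> V" "q \<in> V"
    then obtain x y where "x \<in> adj_dom D A" "y \<in> adj_dom D A" "p = (x, A' x, B' x)" "q = (y, A' y, B' y)"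
      unfolding V_def by blast
    then show "p + q \<in> V" unfolding V_def
      by (intro image_eqI[of _ _ "x + y"]) (auto simp: adj_op_add control_adj_linear)
  next
    fix r :: real and p assume "p \<in> V"
    then obtain x where "x \<in> adj_dom D A" "p = (x, A' x, B' x)" unfolding V_def by blast
    then show "r *\<^sub>R p \<in> V" unfolding V_def
      by (intro image_eqI[of _ _ "r *\<^sub>R x"]) (auto simp: adj_op_scaleR control_adj_linear)
  qed
  \<comment> \<open>The defining identity of the adjoint passes to the limit, so \<open>A'\<close>
    is closed; the sequence then converges in the graph norm, for which \<open>B'\<close> is
    continuous.\<close>
  have "closed V" unfolding closed_sequential_limits
  proof (intro allI impI)
    fix X l assume X: "(\<forall>n. X n \<in> V) \<and> X \<longlonglongrightarrow> l"
    obtain y a b where l: "l = (y, a, b)" by (cases l) auto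
    from X have "\<forall>n. \<exists>y. y \<in> adj_dom D A \<and> X n = (y, A' y, B' y)" unfolding V_def by blast
    then obtain Y where Y: "\<And>n. Y n \<in> adj_dom D A" "\<And>n. X n = (Y n, A' (Y n), B' (Y n))" by metis
    have lim: "Y \<longlonglongrightarrow> y" "(\<lambda>n. A' (Y n)) \<longlonglongrightarrow> a" "(\<lambda>n. B' (Y n)) \<longlonglongrightarrow> b"
      using tendsto_fst[OF conjunct2[OF X]] tendsto_fst[OF tendsto_snd[OF conjunct2[OF X]]]
        tendsto_snd[OF tendsto_snd[OF conjunct2[OF X]]]
      by (simp_all add: l Y(2))
    have "inner (A x) y = inner x a" if x: "x \<in> D" for x
    proof (rule LIMSEQ_unique)
      show "(\<lambda>n. inner (A x) (Y n)) \<longlonglongrightarrow> inner (A x) y" by (intro tendsto_intros lim)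
      have "(\<lambda>n. inner x (A' (Y n))) \<longlonglongrightarrow> inner x a" by (intro tendsto_intros lim)
      then show "(\<lambda>n. inner (A x) (Y n)) \<longlonglongrightarrow> inner x a" by (simp add: inner_adj_op Y(1) x)
    qed
    note y = adj_op_eqI[OF this]
    obtain k where k: "k \<ge> 0" "\<And>y. y \<in> adj_dom D A \<Longrightarrow> norm (B' y) \<le> k * (norm y + norm (A' y))"
      using norm_control_adj_le by blast
    have "(\<lambda>n. B' (Y n) - B' y) \<longlonglongrightarrow> 0"
    proof (rule Lim_null_comparison)
      show "\<forall>\<^sub>F n in sequentially. norm (B' (Y n) - B' y) \<le> k * (norm (Y n - y) + norm (A' (Y n) - a))"
        using k(2)[OF adj_op_diff(1)[OF Y(1) y(1)]]
        by (intro always_eventually) (simp add: adj_op_diff control_adj_linear Y(1) y)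
      have "(\<lambda>n. k * (norm (Y n - y) + norm (A' (Y n) - a))) \<longlonglongrightarrow> k * (norm (y - y) + norm (a - a))"
        by (intro tendsto_intros lim)
      then show "(\<lambda>n. k * (norm (Y n - y) + norm (A' (Y n) - a))) \<longlonglongrightarrow> 0" by simp
    qed
    then have "b = B' y" by (rule LIMSEQ_unique[OF lim(3) LIM_zero_cancel])
    then show "l \<in> V" using y unfolding l V_def by blast
  qed
  have "complete (snd ` V)"
  proof (rule complete_isometric_image)
    \<comment> \<open>The \<open>K\<close> pays for the component y of the graph, and the 1 for the
      other two.\<close>
    show "0 < 1 / (K + 1)" using K by simp
    show "\<forall>p\<in>V. 1 / (K + 1) * norm p \<le> norm (snd p)"
    proof
      fix p assume "p \<in> V"
      then obtain y where y: "y \<in> adj_dom D A" "p = (y, A' y, B' y)" unfolding V_def by blast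
      have "norm p \<le> norm y + norm (A' y, B' y)" unfolding y(2) by (rule norm_Pair_le)
      then show "1 / (K + 1) * norm p \<le> norm (snd p)"
        using K(1) K(2)[OF y(1)] by (simp add: y(2) field_simps)
    qed
  qed (use subV \<open>closed V\<close> bounded_linear_snd in \<open>auto simp: complete_eq_closed\<close>)
  then have clR: "closed (snd ` V)" by (simp add: complete_eq_closed)
  have subR: "subspace (snd ` V)"
    by (rule linear_subspace_image[OF bounded_linear.linear[OF bounded_linear_snd] subV])
  obtain r where r: "r \<in> snd ` V" "\<And>q. q \<in> snd ` V \<Longrightarrow> inner (w - r) q = 0"
    using complete_subspace_orthogonal_projection[OF subR clR, of w] by metis
  \<comment> \<open>Orthogonality to the range is the steady equation, so \<open>w - r\<close> is a
    steady pair. It is orthogonal to \<open>w\<close> by assumption and to \<open>r\<close> by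
    projection, hence to itself.\<close>
  have "inner (w - r) (A' y, B' y) = 0" if "y \<in> adj_dom D A" for y
    by (rule r) (use that in \<open>force simp: V_def\<close>)
  then have "w - r \<in> steady_pairs D A B" using steady_pairs_iff[of "fst (w - r)" "snd (w - r)"]
    unfolding prod.collapse by blast
  then have "inner (w - r) w = 0" by (rule w)
  then have "inner (w - r) (w - r) = 0" using r(2)[OF r(1)] by (simp add: inner_diff_right)
  then have "w = r" by simp
  then show thesis using r(1) that by (auto simp: V_def)
qed

end

section \<open>Strong measurability and square-integrable functions\<close>

text \<open>Strong measurability tolerates exceptional null sets; completeness ensures that such
  limits of real functions are still measurable.\<close>

lemma complete_measure_lebesgue_on:
  assumes "E \<in> sets lebesgue"
  shows "complete_measure (lebesgue_on E)"
proof
  fix X N assume "X \<subseteq> N" "N \<in> null_sets (lebesgue_on E)"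
  then have "N \<in> null_sets lebesgue" "X \<subseteq> E" "N \<subseteq> E"
    using assms by (auto simp: null_sets_restrict_space)
  then show "X \<in> sets (lebesgue_on E)"
    using assms completion.complete2[OF \<open>X \<subseteq> N\<close>] by (simp add: sets_restrict_space_iff null_setsD2)
qed

lemma (in complete_measure) borel_measurable_cong_AE:
  fixes f g :: "'a \<Rightarrow> 'b::topological_space"
  assumes f: "f \<in> borel_measurable M" and ae: "AE x in M. f x = g x"
  shows "g \<in> borel_measurable M"
proof (rule measurableI)
  fix X :: "'b set" assume "X \<in> sets borel"
  then have "f -` X \<inter> space M \<in> sets M" by (rule measurable_sets[OF f])
  then show "g -` X \<inter> space M \<in> sets M"
    by (rule in_sets_AE[rotated]) (use ae in \<open>auto elim: eventually_mono\<close>)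
qed simp

lemma (in complete_measure) borel_measurable_AE_LIMSEQ:
  fixes f :: "'a \<Rightarrow> 'b::{banach, second_countable_topology}"
  assumes "\<And>i. F i \<in> borel_measurable M" "AE x in M. (\<lambda>i. F i x) \<longlonglongrightarrow> f x"
  shows "f \<in> borel_measurable M"
proof (rule borel_measurable_cong_AE)
  show "(\<lambda>x. lim (\<lambda>i. F i x)) \<in> borel_measurable M"
    by (rule borel_measurable_lim_metric[OF assms(1)])
  show "AE x in M. lim (\<lambda>i. F i x) = f x"
    using assms(2) by eventually_elim (rule limI)
qed

text \<open>In a non-separable space a difference of Borel maps need not be Borel. Simple
  approximants avoid this, because the norm of their difference is a real simple function.\<close>

lemma borel_measurable_norm_diff_strongly_measurable:
  fixes f g :: "real \<Rightarrow> 'a::real_normed_vector"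
  assumes "strongly_measurable (lebesgue_on {0..T}) f" "strongly_measurable (lebesgue_on {0..T}) g"
  shows "(\<lambda>t. norm (f t - g t)) \<in> borel_measurable (lebesgue_on {0..T})"
proof -
  let ?M = "lebesgue_on {0..T}"
  interpret complete_measure ?M by (rule complete_measure_lebesgue_on) simp
  obtain F G where F: "\<And>i::nat. simple_function ?M (F i)" "AE t in ?M. (\<lambda>i. F i t) \<longlonglongrightarrow> f t"
    and G: "\<And>i::nat. simple_function ?M (G i)" "AE t in ?M. (\<lambda>i. G i t) \<longlonglongrightarrow> g t"
    using assms unfolding strongly_measurable_def by (elim exE conjE) blast
  show ?thesis
  proof (rule borel_measurable_AE_LIMSEQ)
    show "(\<lambda>t. norm (F i t - G i t)) \<in> borel_measurable ?M" for i
      by (rule borel_measurable_simple_function[OF simple_function_compose2[OF F(1) G(1)]])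
    show "AE t in ?M. (\<lambda>i. norm (F i t - G i t)) \<longlonglongrightarrow> norm (f t - g t)"
      using F(2) G(2) by eventually_elim (rule tendsto_norm, rule tendsto_diff)
  qed
qed

lemma continuous_on_approx_simple_function:
  fixes f :: "real \<Rightarrow> 'a::metric_space"
  assumes f: "continuous_on {0..T} f" and e: "e > 0"
  obtains s where "simple_function (lebesgue_on {0..T}) s" "\<And>t. t \<in> {0..T} \<Longrightarrow> dist (s t) (f t) < e"
proof -
  have "uniformly_continuous_on {0..T} f"
    using f by (rule compact_uniformly_continuous) simp
  then obtain d where d: "d > 0" "\<And>s t. s \<in> {0..T} \<Longrightarrow> t \<in> {0..T} \<Longrightarrow> dist s t < d \<Longrightarrow> dist (f s) (f t) < e"
    using e unfolding uniformly_continuous_on_def by metis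
  \<comment> \<open>The index of the grid cell of t. Sampling at its left end \<open>d * k t\<close>
    never leaves the interval.\<close>
  define k where "k t = \<lfloor>t / d\<rfloor>" for t
  have k: "0 \<le> d * k t" "d * k t \<le> t" "t < d * k t + d" if "t \<ge> 0" for t
  proof -
    have "0 \<le> k t" using that d by (simp add: k_def)
    then show "0 \<le> d * k t" using d by simp
    have "of_int (k t) \<le> t / d" "t / d < of_int (k t) + 1" by (simp_all add: k_def)
    then show "d * k t \<le> t" "t < d * k t + d" using d(1) by (simp_all add: field_simps)
  qed
  have "simple_function (lebesgue_on {0..T}) k"
    unfolding simple_function_eq_measurable
  proof
    have "k ` {0..T} \<subseteq> {0..\<lfloor>T / d\<rfloor>}" using d(1)
      by (auto simp: k_def intro!: floor_mono divide_right_mono)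
    then show "finite (k ` space (lebesgue_on {0..T}))" by (simp add: finite_subset)
    have "k \<in> borel \<rightarrow>\<^sub>M count_space UNIV" unfolding k_def by measurable
    then show "k \<in> lebesgue_on {0..T} \<rightarrow>\<^sub>M count_space UNIV"
      by (intro measurable_restrict_space1 measurable_completion) simp
  qed
  then have "simple_function (lebesgue_on {0..T}) (\<lambda>t. f (d * real_of_int (k t)))"
    by (rule simple_function_compose1)
  moreover have "dist (f (d * real_of_int (k t))) (f t) < e" if "t \<in> {0..T}" for t
    using that k[of t] by (auto intro!: d(2) simp: dist_real_def)
  ultimately show thesis using that by blast
qed

lemma strongly_measurable_AE_LIMSEQ_continuous:
  fixes f :: "real \<Rightarrow> 'a::real_normed_vector"
  assumes F: "\<And>i::nat. continuous_on {0..T} (F i)"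
    and lim: "AE t in lebesgue_on {0..T}. (\<lambda>i. F i t) \<longlonglongrightarrow> f t"
  shows "strongly_measurable (lebesgue_on {0..T}) f"
proof -
  have "\<exists>s. simple_function (lebesgue_on {0..T}) s \<and> (\<forall>t\<in>{0..T}. dist (s t) (F i t) < 1 / Suc i)" for i
    using continuous_on_approx_simple_function[OF F, of "1 / Suc i"] by (metis of_nat_0_less_iff zero_less_Suc zero_less_divide_1_iff)
  then obtain s where s: "\<And>i. simple_function (lebesgue_on {0..T}) (s i)"
    "\<And>i t. t \<in> {0..T} \<Longrightarrow> dist (s i t) (F i t) < 1 / Suc i" by metis
  have "AE t in lebesgue_on {0..T}. (\<lambda>i. s i t) \<longlonglongrightarrow> f t"
    using lim AE_space
  proof eventually_elim
    case (elim t)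
    have "(\<lambda>i. s i t - F i t) \<longlonglongrightarrow> 0"
    proof (rule Lim_null_comparison)
      show "\<forall>\<^sub>F i in sequentially. norm (s i t - F i t) \<le> 1 / Suc i"
        using s(2)[of t] elim(2) by (intro always_eventually) (auto simp: dist_norm less_imp_le)
      show "(\<lambda>i. 1 / real (Suc i)) \<longlonglongrightarrow> 0" by (rule LIMSEQ_Suc[OF lim_1_over_n])
    qed
    from tendsto_add[OF this elim(1)] show ?case by simp
  qed
  then show ?thesis unfolding strongly_measurable_def using s(1) by blast
qed

lemma strongly_measurable_continuous:
  "continuous_on {0..T} f \<Longrightarrow> strongly_measurable (lebesgue_on {0..T}) (f :: real \<Rightarrow> 'a::real_normed_vector)"
  by (rule strongly_measurable_AE_LIMSEQ_continuous[of T "\<lambda>i. f"]) auto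

lemma L2_on_continuous:
  "continuous_on {0..T} f \<Longrightarrow> L2_on T (f :: real \<Rightarrow> 'a::real_normed_vector)"
  unfolding L2_on_def
  by (intro conjI strongly_measurable_continuous continuous_imp_integrable_real continuous_intros)

lemma AE_summable_of_summable_integral:
  fixes f :: "nat \<Rightarrow> 'a \<Rightarrow> real"
  assumes f: "\<And>i. integrable M (f i)" "\<And>i x. f i x \<ge> 0"
    and sum: "summable (\<lambda>i. integral\<^sup>L M (f i))"
  shows "AE x in M. summable (\<lambda>i. f i x)"
proof -
  have [measurable]: "f i \<in> borel_measurable M" for i using f(1) by auto
  have "(\<integral>\<^sup>+x. (\<Sum>i. ennreal (f i x)) \<partial>M) = (\<Sum>i. \<integral>\<^sup>+x. ennreal (f i x) \<partial>M)"
    by (intro nn_integral_suminf) auto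
  also have "\<dots> = (\<Sum>i. ennreal (integral\<^sup>L M (f i)))"
    by (intro arg_cong[where f=suminf] ext nn_integral_eq_integral f AE_I2)
  also have "\<dots> \<noteq> \<infinity>" using f(2) by (simp add: sum ennreal_suminf_neq_top)
  finally have "AE x in M. (\<Sum>i. ennreal (f i x)) \<noteq> \<infinity>"
    by (intro nn_integral_noteq_infinite) auto
  then show ?thesis by eventually_elim (simp add: f(2) summable_suminf_not_top)
qed

text \<open>Time reversal links the two sides of the duality: the control integral up to T sees the
  adjoint orbit at time T - s, the observation at time s.\<close>

lemma integral_reflect_lebesgue_on:
  fixes f :: "real \<Rightarrow> real"
  assumes f: "continuous_on {0..T} f"
  shows "(LINT t|lebesgue_on {0..T}. f (T - t)) = (LINT t|lebesgue_on {0..T}. f t)"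
proof -
  have g: "continuous_on {0..T} (\<lambda>t. f (T - t))"
    by (intro continuous_on_compose2[OF f] continuous_intros) auto
  have h: "continuous_on {0 + (- T)..T + (- T)} (\<lambda>x. f (- x))"
    by (intro continuous_on_compose2[OF f] continuous_intros) auto
  have "integral {0..T} (\<lambda>t. f (T - t)) = integral {0..T} ((\<lambda>x. f (- x)) \<circ> (\<lambda>x. x + (- T)))"
    by (intro integral_cong) simp
  also have "\<dots> = integral {0 + (- T)..T + (- T)} (\<lambda>x. f (- x))" by (rule integral_shift[OF h])
  also have "\<dots> = integral {0..T} f" using Henstock_Kurzweil_Integration.integral_reflect_real[of T 0 f] by simp
  finally show ?thesis
    using f g by (simp add: lebesgue_integral_eq_integral continuous_imp_integrable_real)
qed

lemma weighted_Cauchy_Schwarz_sum: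
  fixes w a :: "'i \<Rightarrow> real"
  assumes "\<And>i. i \<in> I \<Longrightarrow> w i \<ge> 0"
  shows "(\<Sum>i\<in>I. w i * a i)\<^sup>2 \<le> (\<Sum>i\<in>I. w i) * (\<Sum>i\<in>I. w i * (a i)\<^sup>2)"
proof -
  have "(\<Sum>i\<in>I. sqrt (w i) * (sqrt (w i) * a i))\<^sup>2 \<le> (\<Sum>i\<in>I. (sqrt (w i))\<^sup>2) * (\<Sum>i\<in>I. (sqrt (w i) * a i)\<^sup>2)"
    by (rule Cauchy_Schwarz_ineq_sum)
  moreover have "(\<Sum>i\<in>I. sqrt (w i) * (sqrt (w i) * a i)) = (\<Sum>i\<in>I. w i * a i)"
    by (intro sum.cong) (use assms in \<open>simp_all flip: mult.assoc\<close>)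
  moreover have "(\<Sum>i\<in>I. (sqrt (w i))\<^sup>2) = (\<Sum>i\<in>I. w i)" by (intro sum.cong) (use assms in simp_all)
  moreover have "(\<Sum>i\<in>I. (sqrt (w i) * a i)\<^sup>2) = (\<Sum>i\<in>I. w i * (a i)\<^sup>2)"
    by (intro sum.cong) (use assms in \<open>simp_all add: power_mult_distrib\<close>)
  ultimately show ?thesis by simp
qed

text \<open>The function is the sum of e m * (1/3) ^ m * G m, with signs e m chosen one after the other so
  that the n-th pairing is not cancelled by the earlier terms. The sum converges only almost
  everywhere, dominated by a square-integrable function.\<close>

lemma exists_L2_on_integral_inner_ge:
  fixes G :: "nat \<Rightarrow> real \<Rightarrow> 'u::{real_inner, complete_space}"
  assumes cont: "\<And>n. continuous_on {0..T} (G n)"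
    and unit: "\<And>n. (LINT t|lebesgue_on {0..T}. (norm (G n t))\<^sup>2) = 1"
  obtains u where "L2_on T u"
    "\<And>n. (1/3) ^ n / 2 \<le> \<bar>LINT t|lebesgue_on {0..T}. inner (u t) (G n t)\<bar>"
proof -
  let ?M = "lebesgue_on {0..T}"
  interpret complete_measure ?M by (rule complete_measure_lebesgue_on) simp
  note int = continuous_imp_integrable_real
  define a where "a m n = (LINT t|?M. inner (G m t) (G n t))" for m n
  have int_a: "integrable ?M (\<lambda>t. inner (G m t) (G n t))" for m n
    by (intro int continuous_intros cont)
  have int_n: "integrable ?M (\<lambda>t. (norm (G n t))\<^sup>2)" for n
    by (intro int continuous_intros cont)
  have a_le: "\<bar>a m n\<bar> \<le> 1" for m n
  proof -
    have "\<bar>a m n\<bar> \<le> (LINT t|?M. \<bar>inner (G m t) (G n t)\<bar>)" unfolding a_def by (rule integral_abs_bound)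
    also have "\<dots> \<le> (LINT t|?M. ((norm (G m t))\<^sup>2 + (norm (G n t))\<^sup>2) / 2)"
    proof (rule integral_mono)
      show "\<bar>inner (G m t) (G n t)\<bar> \<le> ((norm (G m t))\<^sup>2 + (norm (G n t))\<^sup>2) / 2" for t
      proof -
        have "2 * \<bar>inner (G m t) (G n t)\<bar> \<le> 2 * (norm (G m t) * norm (G n t))"
          by (intro mult_left_mono Cauchy_Schwarz_ineq2) simp
        also have "\<dots> \<le> (norm (G m t))\<^sup>2 + (norm (G n t))\<^sup>2"
          using sum_squares_bound[of "norm (G m t)" "norm (G n t)"] by (simp add: mult.assoc)
        finally show ?thesis by simp
      qed
    qed (use int_a int_n in simp_all)
    also have "\<dots> = 1" using int_n unit by simp
    finally show ?thesis .
  qed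
  have a_diag: "a n n = 1" for n using unit[of n] by (simp add: a_def power2_norm_eq_inner)
  define w where "w m = (1/3::real) ^ m" for m
  have w: "w m > 0" "summable w" "suminf w = 3/2" for m
    by (simp_all add: w_def[abs_def] summable_geometric suminf_geometric)
  obtain e :: "nat \<Rightarrow> real" where e1: "\<And>n. \<bar>e n\<bar> = 1" and
    e: "\<And>n. norm (w n *\<^sub>R a n n) \<le> norm (\<Sum>m\<le>n. e m *\<^sub>R (w m *\<^sub>R a m n))"
    using alternating_signs_sum_norm_ge[of "\<lambda>n m. w m *\<^sub>R a m n"] by metis
  define P where "P k t = (\<Sum>m<k. (e m * w m) *\<^sub>R G m t)" for k t
  define u where "u t = (\<Sum>m. (e m * w m) *\<^sub>R G m t)" for t
  \<comment> \<open>Its integral is the sum of the weights. Weighted Cauchy-Schwarz bounds the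
    squared norm of every partial sum by 3/2 times \<open>H\<close>, the factor being again the sum
    of the weights.\<close>
  define H where "H t = (\<Sum>m. w m * (norm (G m t))\<^sup>2)" for t
  have contP: "continuous_on {0..T} (P k)" for k
    unfolding P_def[abs_def] by (intro continuous_intros cont)
  have int_w: "integrable ?M (\<lambda>t. w m * (norm (G m t))\<^sup>2)" for m
    by (intro int continuous_intros cont)
  have sum_w: "summable (\<lambda>m. LINT t|?M. w m * (norm (G m t))\<^sup>2)"
    using w(2) by (simp add: unit)
  have ae: "AE t in ?M. summable (\<lambda>m. w m * (norm (G m t))\<^sup>2)"
    by (rule AE_summable_of_summable_integral[OF int_w _ sum_w]) (simp add: w(1) less_imp_le)
  have int_H: "integrable ?M H"
    unfolding H_def using int_w ae sum_w w(1) less_imp_le[OF w(1)]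
    by (intro integrable_suminf) (simp_all add: abs_mult abs_of_nonneg)
  have lim: "(\<lambda>k. P k t) \<longlonglongrightarrow> u t" and bound: "(norm (P k t))\<^sup>2 \<le> 3/2 * H t"
    if s: "summable (\<lambda>m. w m * (norm (G m t))\<^sup>2)" for t k
  proof -
    have norm_eq: "norm ((e m * w m) *\<^sub>R G m t) = w m * norm (G m t)" for m
      using w(1)[of m] by (simp add: abs_mult e1)
    have "summable (\<lambda>m. norm ((e m * w m) *\<^sub>R G m t))"
    proof (rule summable_comparison_test'[of _ 0])
      show "summable (\<lambda>m. w m + w m * (norm (G m t))\<^sup>2)" by (intro summable_add w(2) s)
      fix m
      \<comment> \<open>As the weights are summable, convergence of the weighted squares gives
        absolute convergence of the series itself.\<close>
      have "norm (G m t) \<le> 1 + (norm (G m t))\<^sup>2"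
        using sum_squares_bound[of 1 "norm (G m t)"] norm_ge_zero[of "G m t"] by (simp, linarith)
      then have "w m * norm (G m t) \<le> w m * (1 + (norm (G m t))\<^sup>2)"
        using w(1)[of m] by (intro mult_left_mono) auto
      then show "norm (norm ((e m * w m) *\<^sub>R G m t)) \<le> w m + w m * (norm (G m t))\<^sup>2"
        unfolding norm_eq using w(1)[of m] by (simp add: algebra_simps)
    qed
    then show "(\<lambda>k. P k t) \<longlonglongrightarrow> u t"
      unfolding P_def u_def by (rule summable_LIMSEQ[OF summable_norm_cancel_complete_space])
    have "norm (P k t) \<le> (\<Sum>m<k. w m * norm (G m t))"
      unfolding P_def by (rule sum_norm_le) (simp only: norm_eq order_refl)
    then have "(norm (P k t))\<^sup>2 \<le> (\<Sum>m<k. w m * norm (G m t))\<^sup>2" by (rule power_mono) simp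
    also have "\<dots> \<le> (\<Sum>m<k. w m) * (\<Sum>m<k. w m * (norm (G m t))\<^sup>2)"
      by (rule weighted_Cauchy_Schwarz_sum) (simp add: w(1) less_imp_le)
    also have "\<dots> \<le> suminf w * H t"
      unfolding H_def using w(1) s w(2)
      by (intro mult_mono sum_le_suminf sum_nonneg suminf_nonneg) (simp_all add: less_imp_le)
    finally show "(norm (P k t))\<^sup>2 \<le> 3/2 * H t" by (simp add: w(3))
  qed
  have "L2_on T u" unfolding L2_on_def
  proof
    show "strongly_measurable ?M u"
    proof (rule strongly_measurable_AE_LIMSEQ_continuous[of T P, OF contP])
      show "AE t in ?M. (\<lambda>k. P k t) \<longlonglongrightarrow> u t" using ae by eventually_elim (rule lim)
    qed
    show "integrable ?M (\<lambda>t. (norm (u t))\<^sup>2)"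
    proof (rule integrable_dominated_convergence)
      show meas: "(\<lambda>t. (norm (P k t))\<^sup>2) \<in> borel_measurable ?M" for k
        by (intro borel_measurable_integrable int continuous_intros contP)
      show lim2: "AE t in ?M. (\<lambda>k. (norm (P k t))\<^sup>2) \<longlonglongrightarrow> (norm (u t))\<^sup>2"
        using ae by eventually_elim (intro tendsto_power tendsto_norm lim)
      show "(\<lambda>t. (norm (u t))\<^sup>2) \<in> borel_measurable ?M"
        by (rule borel_measurable_AE_LIMSEQ[OF meas lim2])
      show "integrable ?M (\<lambda>t. 3/2 * H t)" using int_H by simp
      show "AE t in ?M. norm ((norm (P k t))\<^sup>2) \<le> 3/2 * H t" for k
        using ae by eventually_elim (simp only: real_norm_def abs_power2 bound)
    qed
  qed
  moreover have "(1/3) ^ n / 2 \<le> \<bar>LINT t|?M. inner (u t) (G n t)\<bar>" for n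
  proof -
    define b where "b m = e m * w m * a m n" for m
    have intPG: "integrable ?M (\<lambda>t. inner (P k t) (G n t))" for k
      by (intro int continuous_intros contP cont)
    have PG: "(LINT t|?M. inner (P k t) (G n t)) = (\<Sum>m<k. b m)" for k
      unfolding P_def b_def a_def inner_sum_left inner_scaleR_left
      by (subst Bochner_Integration.integral_sum) (simp_all add: int_a)
    have "bounded (G n ` {0..T})"
      by (intro compact_imp_bounded compact_continuous_image cont) simp
    then obtain c where c: "c > 0" "\<And>t. t \<in> {0..T} \<Longrightarrow> norm (G n t) \<le> c"
      unfolding bounded_pos by auto
    have "(\<lambda>k. LINT t|?M. inner (P k t) (G n t)) \<longlonglongrightarrow> (LINT t|?M. inner (u t) (G n t))"
    proof (rule integral_dominated_convergence)
      show meas: "(\<lambda>t. inner (P k t) (G n t)) \<in> borel_measurable ?M" for k using intPG by auto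
      show lim2: "AE t in ?M. (\<lambda>k. inner (P k t) (G n t)) \<longlonglongrightarrow> inner (u t) (G n t)"
        using ae by eventually_elim (intro tendsto_inner tendsto_const lim)
      show "(\<lambda>t. inner (u t) (G n t)) \<in> borel_measurable ?M"
        by (rule borel_measurable_AE_LIMSEQ[OF meas lim2])
      \<comment> \<open>\<open>H\<close> dominates squares, whereas the pairing is of first order; r
        at most 1 + r^2 bridges the gap, and \<open>c\<close> bounds the continuous function
        \<open>G n\<close>.\<close>
      show "integrable ?M (\<lambda>t. (1 + 3/2 * H t) * c)"
        using int_H int[of 0 T "\<lambda>_. 1::real"] by (intro integrable_mult_left Bochner_Integration.integrable_add) auto
      show "AE t in ?M. norm (inner (P k t) (G n t)) \<le> (1 + 3/2 * H t) * c" for k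
        using ae AE_space
      proof eventually_elim
        case (elim t)
        have "norm (P k t) \<le> 1 + (norm (P k t))\<^sup>2"
          using sum_squares_bound[of 1 "norm (P k t)"] norm_ge_zero[of "P k t"] by (simp, linarith)
        also have "\<dots> \<le> 1 + 3/2 * H t" using bound[OF elim(1)] by simp
        finally have "norm (P k t) * norm (G n t) \<le> (1 + 3/2 * H t) * c"
          using c elim(2) by (intro mult_mono') auto
        then show ?case using Cauchy_Schwarz_ineq2[of "P k t" "G n t"] by simp
      qed
    qed
    then have "b sums (LINT t|?M. inner (u t) (G n t))" unfolding PG sums_def .
    then have ub: "summable b" "(LINT t|?M. inner (u t) (G n t)) = suminf b"
      by (simp_all add: sums_iff)
    have b_le: "\<bar>b m\<bar> \<le> 1 * (1/3) ^ m" for m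
      using mult_left_le[OF a_le, of "\<bar>e m * w m\<bar>"] w(1)[of m]
      by (simp add: b_def abs_mult e1 w_def)
    have split: "suminf b = (\<Sum>m. b (m + Suc n)) + sum b {..<Suc n}"
      by (rule suminf_split_initial_segment[OF ub(1)])
    have "norm (\<Sum>m. b (m + Suc n)) \<le> (\<Sum>m. 1 * (1/3) ^ (m + Suc n))"
    proof (rule norm_suminf_le_complete_space)
      have "summable (\<lambda>m. (1/3::real) ^ m)" by (rule summable_geometric) simp
      from summable_ignore_initial_segment[OF this, of "Suc n"]
      show "summable (\<lambda>m. 1 * (1/3::real) ^ (m + Suc n))" by simp
    qed (simp only: real_norm_def b_le)
    then have "\<bar>\<Sum>m. b (m + Suc n)\<bar> \<le> (1/3) ^ n / 2" unfolding suminf_geometric_tail by simp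
    moreover have "(1/3) ^ n \<le> \<bar>sum b {..<Suc n}\<bar>"
      using e[of n] w(1)[of n] by (simp add: a_diag b_def lessThan_Suc_atMost mult.assoc w_def)
    ultimately show ?thesis unfolding ub(2) split by linarith
  qed
  ultimately show thesis using that by blast
qed

section \<open>Observation of adjoint orbits and the dual coercivity estimate\<close>

context control_system
begin

definition obs :: "'h \<Rightarrow> real \<Rightarrow> 'u" where "obs y t = B' (S' t y)"

text \<open>\<open>A'\<close> commutes with the adjoint semigroup, so orbits in its domain are
  continuous in the graph norm, where \<open>B'\<close> is bounded.\<close>

lemma continuous_on_obs:
  assumes y: "y \<in> adj_dom D A"
  shows "continuous_on {0..T} (obs y)"
  unfolding continuous_on_def
proof
  fix s assume s: "s \<in> {0..T}"
  obtain K where K: "K \<ge> 0" "\<And>y. y \<in> adj_dom D A \<Longrightarrow> norm (B' y) \<le> K * (norm y + norm (A' y))"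
    using norm_control_adj_le by blast
  have lim: "((\<lambda>t. S' t x) \<longlongrightarrow> S' s x) (at s within {0..T})" for x
    using continuous_on_S'[of T x] s by (auto simp: continuous_on_def)
  have "((\<lambda>t. obs y t - obs y s) \<longlongrightarrow> 0) (at s within {0..T})"
  proof (rule Lim_null_comparison)
    have "\<forall>\<^sub>F t in at s within {0..T}. t \<in> {0..T}" by (simp add: eventually_at_filter)
    then show "\<forall>\<^sub>F t in at s within {0..T}. norm (obs y t - obs y s)
        \<le> K * (norm (S' t y - S' s y) + norm (S' t (A' y) - S' s (A' y)))"
    proof eventually_elim
      case (elim t)
      have "norm (B' (S' t y - S' s y)) \<le> K * (norm (S' t y - S' s y) + norm (A' (S' t y - S' s y)))"
        using y s elim by (intro K adj_op_diff S'_in_adj_dom) auto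
      then show ?case
        using y s elim by (simp add: obs_def control_adj_linear adj_op_diff S'_in_adj_dom)
    qed
    have "((\<lambda>t. K * (norm (S' t y - S' s y) + norm (S' t (A' y) - S' s (A' y)))) \<longlongrightarrow>
        K * (norm (S' s y - S' s y) + norm (S' s (A' y) - S' s (A' y)))) (at s within {0..T})"
      by (intro tendsto_intros lim)
    then show "((\<lambda>t. K * (norm (S' t y - S' s y) + norm (S' t (A' y) - S' s (A' y)))) \<longlongrightarrow> 0)
        (at s within {0..T})" by simp
  qed
  then show "(obs y \<longlongrightarrow> obs y s) (at s within {0..T})" by (rule LIM_zero_cancel)
qed

lemma obs_linear:
  assumes "x \<in> adj_dom D A" "y \<in> adj_dom D A" "t \<ge> 0"
  shows "obs (x - y) t = obs x t - obs y t" "obs (r *\<^sub>R x) t = r *\<^sub>R obs x t"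
  using assms by (simp_all add: obs_def S'_linear control_adj_linear S'_in_adj_dom)

text \<open>The constant is extracted by contradiction. Normalised counterexamples
  \<open>x n\<close> have observations of unit L2 norm but norms at most (1/9) ^ n. A control whose
  pairing with each reversed observation is at least (1/3) ^ n / 2 would reach a state
  \<open>v T\<close> of norm at least 3 ^ n / 2 for all n.\<close>

lemma obs_L2_bounded:
  assumes T: "T > 0" and adm: "admissible D A S B"
  obtains K where "K > 0"
    "\<And>y. y \<in> adj_dom D A \<Longrightarrow> (LINT t|lebesgue_on {0..T}. (norm (obs y t))\<^sup>2) \<le> K * (norm y)\<^sup>2"
proof (rule ccontr)
  assume neg: "\<not> thesis"
  let ?M = "lebesgue_on {0..T}"
  define J where "J y = (LINT t|?M. (norm (obs y t))\<^sup>2)" for y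
  \<comment> \<open>81 is the square of 9, since \<open>J\<close> is quadratic in y.\<close>
  have "\<exists>y\<in>adj_dom D A. J y > 81 ^ n * (norm y)\<^sup>2" for n :: nat
  proof (rule ccontr)
    assume "\<not> ?thesis"
    then show False using neg that[of "81 ^ n"] by (auto simp: J_def not_less)
  qed
  then obtain y where y: "\<And>n. y n \<in> adj_dom D A" "\<And>n. J (y n) > 81 ^ n * (norm (y n))\<^sup>2" by metis
  have Jpos: "J (y n) > 0" for n using y(2)[of n] by (smt (verit) zero_le_power2 zero_less_power mult_nonneg_nonneg)
  define x where "x n = (1 / sqrt (J (y n))) *\<^sub>R y n" for n
  have x: "x n \<in> adj_dom D A" for n unfolding x_def by (rule adj_op_scaleR(1)[OF y(1)])
  have norm_x: "norm (x n) \<le> (1/9) ^ n" for n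
  proof (rule power2_le_imp_le)
    have "(norm (x n))\<^sup>2 = (norm (y n))\<^sup>2 / J (y n)"
      using Jpos[of n] by (simp add: x_def power_divide)
    also have "\<dots> \<le> (1/81) ^ n"
      using y(2)[of n] Jpos[of n] by (simp add: field_simps power_divide)
    also have "(1/81::real) ^ n = ((1/9) ^ n)\<^sup>2" by (simp add: power_divide flip: power_mult_distrib power2_eq_square) (simp add: power2_eq_square flip: power_mult_distrib)
    finally show "(norm (x n))\<^sup>2 \<le> ((1/9) ^ n)\<^sup>2" .
  qed simp
  have J_x: "J (x n) = 1" for n
  proof -
    have "J (x n) = (LINT t|?M. (1 / J (y n)) * (norm (obs (y n) t))\<^sup>2)"
      unfolding J_def x_def
    proof (rule Bochner_Integration.integral_cong)
      fix t assume "t \<in> space ?M"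
      then have "t \<ge> 0" by simp
      then show "(norm (obs ((1 / sqrt (LINT t|?M. (norm (obs (y n) t))\<^sup>2)) *\<^sub>R y n) t))\<^sup>2 =
        (1 / (LINT t|?M. (norm (obs (y n) t))\<^sup>2)) * (norm (obs (y n) t))\<^sup>2"
        using Jpos[of n] by (simp add: obs_linear(2)[OF y(1) y(1)] power_mult_distrib power_divide J_def)
    qed simp
    also have "\<dots> = (1 / J (y n)) * J (y n)" by (simp add: J_def)
    finally show ?thesis using Jpos[of n] by simp
  qed
  define G where "G n t = obs (x n) (T - t)" for n t
  have contG: "continuous_on {0..T} (G n)" for n
    unfolding G_def[abs_def]
    by (rule continuous_on_compose2[OF continuous_on_obs[OF x, of T]]) (auto intro!: continuous_intros)
  have unitG: "(LINT t|?M. (norm (G n t))\<^sup>2) = 1" for n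
    unfolding G_def
    using integral_reflect_lebesgue_on[of T "\<lambda>t. (norm (obs (x n) t))\<^sup>2"] J_x[of n]
    by (simp add: J_def continuous_intros continuous_on_obs x)
  obtain u where u: "L2_on T u" "\<And>n. (1/3) ^ n / 2 \<le> \<bar>LINT t|?M. inner (u t) (G n t)\<bar>"
    using exists_L2_on_integral_inner_ge[of T G, OF contG unitG] by blast
  obtain v where v: "\<And>t. t \<in> {0..T} \<Longrightarrow>
      is_dual_integral D A t (\<lambda>s. semigroup_ext S (t - s) (B (u s))) (inner (v t))"
    using adm T u(1) unfolding admissible_def by blast
  have "3 ^ n \<le> 2 * norm (v T)" for n :: nat
  proof -
    have "inner (v T) (x n) = (LINT s|?M. semigroup_ext S (T - s) (B (u s)) (x n))"
      using v[of T] T x unfolding is_dual_integral_def by auto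
    also have "\<dots> = (LINT s|?M. inner (u s) (G n s))"
      by (rule Bochner_Integration.integral_cong)
        (auto simp: semigroup_ext_def G_def obs_def inner_control_adj S'_in_adj_dom x)
    finally have "(1/3) ^ n / 2 \<le> norm (v T) * norm (x n)"
      using u(2)[of n] Cauchy_Schwarz_ineq2[of "v T" "x n"] by simp
    also have "\<dots> \<le> norm (v T) * (1/9) ^ n" by (intro mult_left_mono norm_x) simp
    finally have "(1/3) ^ n / 2 * 9 ^ n \<le> norm (v T) * (1/9) ^ n * 9 ^ n" by (rule mult_right_mono) simp
    moreover have "(1/3::real) ^ n * 9 ^ n = 3 ^ n" "(1/9::real) ^ n * 9 ^ n = 1"
      by (simp_all flip: power_mult_distrib)
    ultimately show ?thesis by (simp add: mult.assoc)
  qed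
  moreover obtain n where "2 * norm (v T) < 3 ^ n" using real_arch_pow[of 3 "2 * norm (v T)"] by auto
  ultimately show False by (meson not_le)
qed

text \<open>By linearity the L2 bound applies to \<open>X n - y\<close>. The choice in
  \<open>observation\<close> thus has a candidate at y, and its defining property may be
  used.\<close>

lemma is_observation_ext_obs:
  assumes T: "T > 0" and adm: "admissible D A S B" and y: "y \<in> adj_dom D A"
  shows "is_observation_ext D A S B T y (obs y)"
  unfolding is_observation_ext_def
proof (intro conjI allI impI)
  show "L2_on T (obs y)" by (rule L2_on_continuous[OF continuous_on_obs[OF y]])
  fix X :: "nat \<Rightarrow> 'h" assume X: "(\<forall>n. X n \<in> adj_dom D A) \<and> X \<longlonglongrightarrow> y"
  obtain K where K: "K > 0"
    "\<And>y. y \<in> adj_dom D A \<Longrightarrow> (LINT t|lebesgue_on {0..T}. (norm (obs y t))\<^sup>2) \<le> K * (norm y)\<^sup>2"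
    using obs_L2_bounded[OF T adm] by blast
  show "(\<lambda>n. LINT t|lebesgue_on {0..T}. (norm (B' (S' t (X n)) - obs y t))\<^sup>2) \<longlonglongrightarrow> 0"
  proof (rule Lim_null_comparison)
    show "\<forall>\<^sub>F n in sequentially. norm (LINT t|lebesgue_on {0..T}. (norm (B' (S' t (X n)) - obs y t))\<^sup>2)
        \<le> K * (norm (X n - y))\<^sup>2"
    proof (intro always_eventually allI)
      fix n
      have Xn: "X n \<in> adj_dom D A" using X by blast
      have "(LINT t|lebesgue_on {0..T}. (norm (B' (S' t (X n)) - obs y t))\<^sup>2) =
          (LINT t|lebesgue_on {0..T}. (norm (obs (X n - y) t))\<^sup>2)"
        by (rule Bochner_Integration.integral_cong)
          (auto simp: obs_linear(1)[OF Xn y] obs_def[of "X n"])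
      also have "\<dots> \<le> K * (norm (X n - y))\<^sup>2" by (intro K adj_op_diff Xn y)
      finally show "norm (LINT t|lebesgue_on {0..T}. (norm (B' (S' t (X n)) - obs y t))\<^sup>2)
          \<le> K * (norm (X n - y))\<^sup>2" by simp
    qed
    have "(\<lambda>n. K * (norm (X n - y))\<^sup>2) \<longlonglongrightarrow> K * (norm (y - y))\<^sup>2"
      using X by (intro tendsto_intros) auto
    then show "(\<lambda>n. K * (norm (X n - y))\<^sup>2) \<longlonglongrightarrow> 0" by simp
  qed
qed

lemma integral_observation_eq:
  assumes T: "T > 0" and adm: "admissible D A S B" and y: "y \<in> adj_dom D A"
  shows "(LINT t|lebesgue_on {0..T}. (norm (observation D A S B T y t))\<^sup>2) =
    (LINT t|lebesgue_on {0..T}. (norm (obs y t))\<^sup>2)"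
proof -
  let ?M = "lebesgue_on {0..T}"
  interpret complete_measure ?M by (rule complete_measure_lebesgue_on) simp
  define f where "f = observation D A S B T y"
  have "is_observation_ext D A S B T y f"
    unfolding f_def observation_def
    by (rule someI_ex[of "is_observation_ext D A S B T y"]) (use is_observation_ext_obs[OF assms] in blast)
  then have f: "L2_on T f" and lim: "(\<forall>n. X n \<in> adj_dom D A) \<and> X \<longlonglongrightarrow> y \<Longrightarrow>
    (\<lambda>n. LINT t|?M. (norm (B' (S' t (X n)) - f t))\<^sup>2) \<longlonglongrightarrow> 0" for X :: "nat \<Rightarrow> 'h"
    unfolding is_observation_ext_def by blast+
  \<comment> \<open>The constant sequence y is a legitimate approximation, so the chosen
    representative has zero L2 distance from \<open>obs y\<close>.\<close>
  have "(\<lambda>n::nat. LINT t|?M. (norm (obs y t - f t))\<^sup>2) \<longlonglongrightarrow> 0"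
    using lim[of "\<lambda>_. y"] y by (simp add: obs_def)
  then have zero: "(LINT t|?M. (norm (obs y t - f t))\<^sup>2) = 0"
    using LIMSEQ_unique[OF tendsto_const] by blast
  have g: "L2_on T (obs y)" by (rule L2_on_continuous[OF continuous_on_obs[OF y]])
  have meas: "(\<lambda>t. norm (obs y t - f t)) \<in> borel_measurable ?M"
    using f g unfolding L2_on_def by (intro borel_measurable_norm_diff_strongly_measurable) auto
  \<comment> \<open>Without integrability a zero integral would say nothing, 0 being the default
    value.\<close>
  have int: "integrable ?M (\<lambda>t. (norm (obs y t - f t))\<^sup>2)"
  proof (rule Bochner_Integration.integrable_bound)
    show "integrable ?M (\<lambda>t. 2 * (norm (obs y t))\<^sup>2 + 2 * (norm (f t))\<^sup>2)"
      using f g unfolding L2_on_def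
      by (intro Bochner_Integration.integrable_add integrable_mult_right) auto
    show "(\<lambda>t. (norm (obs y t - f t))\<^sup>2) \<in> borel_measurable ?M" using meas by measurable
    have "(norm (obs y t - f t))\<^sup>2 \<le> 2 * (norm (obs y t))\<^sup>2 + 2 * (norm (f t))\<^sup>2" for t
    proof -
      have "(norm (obs y t - f t))\<^sup>2 \<le> (norm (obs y t) + norm (f t))\<^sup>2"
        by (intro power_mono norm_triangle_ineq4) simp
      also have "\<dots> \<le> 2 * (norm (obs y t))\<^sup>2 + 2 * (norm (f t))\<^sup>2"
        using sum_squares_bound[of "norm (obs y t)" "norm (f t)"] by (simp add: power2_sum)
      finally show ?thesis .
    qed
    then show "AE t in ?M. norm ((norm (obs y t - f t))\<^sup>2)
        \<le> norm (2 * (norm (obs y t))\<^sup>2 + 2 * (norm (f t))\<^sup>2)" by simp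
  qed
  have "AE t in ?M. (norm (obs y t - f t))\<^sup>2 = 0"
    using integral_nonneg_eq_0_iff_AE[OF int] zero by simp
  then have ae: "AE t in ?M. (norm (obs y t))\<^sup>2 = (norm (f t))\<^sup>2" by eventually_elim simp
  show ?thesis unfolding f_def[symmetric]
  proof (rule integral_cong_AE)
    show "(\<lambda>t. (norm (obs y t))\<^sup>2) \<in> borel_measurable ?M" "(\<lambda>t. (norm (f t))\<^sup>2) \<in> borel_measurable ?M"
      using f g unfolding L2_on_def by auto
    show "AE t in ?M. (norm (f t))\<^sup>2 = (norm (obs y t))\<^sup>2" using ae by eventually_elim simp
  qed
qed

text \<open>Dual of \<open>steady_pairs_coercive\<close>. The drift is now
  \<open>I' t (A' y)\<close>, so along the orbit the observation is \<open>B' y\<close> plus a term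
  bounded by the norm of \<open>A' y\<close>.\<close>

lemma adjoint_coercive:
  assumes T: "T > 0" and adm: "admissible D A S B" and c: "c > 0"
    and ineq: "\<And>y. (LINT t|lebesgue_on {0..T}. (norm (observation D A S B T y t))\<^sup>2) \<ge> c * (norm (S' T y))\<^sup>2"
  obtains K where "K > 0" "\<And>y. y \<in> adj_dom D A \<Longrightarrow> norm y \<le> K * norm (A' y, B' y)"
proof -
  obtain M where M: "M \<ge> 1" "\<And>t x. 0 \<le> t \<Longrightarrow> t \<le> T \<Longrightarrow> norm (I' t x) \<le> t * M * norm x"
    using S'_bounded[of T] by metis
  obtain L where L: "L \<ge> 0" "\<And>t y. 0 \<le> t \<Longrightarrow> t \<le> T \<Longrightarrow> norm (B' (I' t y)) \<le> L * norm y"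
    using norm_control_adj_I'_le[of T] T by (metis less_imp_le)
  define K where "K = sqrt (T / c) * (1 + L) + T * M"
  have "norm y \<le> K * norm (A' y, B' y)" if y: "y \<in> adj_dom D A" for y
  proof -
    define n where "n = norm (A' y, B' y)"
    have An: "norm (A' y) \<le> n" and Bn: "norm (B' y) \<le> n" and n0: "n \<ge> 0"
      unfolding n_def by (rule norm_fst_le norm_snd_le norm_ge_zero)+
    have S_eq: "S' t y = y + I' t (A' y)" if "t \<ge> 0" for t using S'_diff[OF y that] by (simp add: algebra_simps)
    define R where "R = (1 + L) * n"
    have R0: "R \<ge> 0" using L n0 by (simp add: R_def)
    have le: "(norm (obs y t))\<^sup>2 \<le> R\<^sup>2" if t: "t \<in> {0..T}" for t
    proof (rule power_mono)
      have "obs y t = B' y + B' (I' t (A' y))"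
        using t y by (simp add: obs_def S_eq control_adj_linear I'_in_adj_dom)
      then have "norm (obs y t) \<le> norm (B' y) + norm (B' (I' t (A' y)))" by (metis norm_triangle_ineq)
      also have "\<dots> \<le> n + L * n"
        using L(2)[of t "A' y"] t Bn mult_left_mono[OF An L(1)] by auto
      finally show "norm (obs y t) \<le> R" by (simp add: R_def algebra_simps)
    qed simp
    have "c * (norm (S' T y))\<^sup>2 \<le> (LINT t|lebesgue_on {0..T}. (norm (obs y t))\<^sup>2)"
      using ineq[of y] unfolding integral_observation_eq[OF T adm y] .
    also have "\<dots> \<le> (LINT t|lebesgue_on {0..T}. R\<^sup>2)"
      by (rule integral_mono') (use le in \<open>auto simp: space_restrict_space\<close>)
    also have "\<dots> = T * R\<^sup>2" using T by (simp add: measure_restrict_space)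
    finally have "(norm (S' T y))\<^sup>2 \<le> T / c * R\<^sup>2" using c by (simp add: field_simps)
    then have "sqrt ((norm (S' T y))\<^sup>2) \<le> sqrt (T / c * R\<^sup>2)" by (rule real_sqrt_le_mono)
    also have "sqrt (T / c * R\<^sup>2) = sqrt (T / c) * R" using R0 by (subst real_sqrt_mult) simp
    finally have "norm (S' T y) \<le> sqrt (T / c) * R" by simp
    moreover have "norm y \<le> norm (S' T y) + norm (I' T (A' y))"
      using norm_triangle_ineq4[of "S' T y" "I' T (A' y)"] S_eq[of T] T by simp
    moreover have "norm (I' T (A' y)) \<le> T * M * n"
      by (rule order_trans[OF M(2) mult_left_mono[OF An]]) (use M(1) T in auto)
    ultimately show ?thesis by (simp add: K_def R_def n_def algebra_simps)
  qed
  moreover have "K > 0" using L(1) M(1) T c unfolding K_def by (intro add_nonneg_pos) auto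
  ultimately show thesis using that by blast
qed

end

theorem proposition1p1:
  fixes D :: "'h::{real_inner, complete_space} set"
    and A :: "'h \<Rightarrow> 'h"
    and S :: "real \<Rightarrow> 'h \<Rightarrow> 'h"
    and B :: "'u::{real_inner, complete_space} \<Rightarrow> 'h \<Rightarrow> real"
    and C :: "'h \<Rightarrow> 'h"
    and z :: 'h
    and T\<^sub>0 c :: real
  assumes "generates D A S"
    and "control_operator D A B"
    and "admissible D A S B"
    and "bounded_linear C"
    and "{x \<in> D. A x = 0} \<inter> {x. C x = 0} = {0}"
    and "T\<^sub>0 > 0" and "c > 0"
    and "\<forall>\<xi>. (LINT t|lebesgue_on {0..T\<^sub>0}. (norm (C (S t \<xi>)))\<^sup>2) \<ge> c * (norm (S T\<^sub>0 \<xi>))\<^sup>2"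
  shows "(\<exists>!p. optimal_steady_pair D A B C z p) \<and>
    ({\<phi> \<in> adj_dom D A. adj_op D A \<phi> = 0} \<inter> {\<phi> \<in> adj_dom D A. control_adj B \<phi> = 0} = {0} \<and>
     (\<exists>c'>0. \<forall>\<xi>. (LINT t|lebesgue_on {0..T\<^sub>0}. (norm (observation D A S B T\<^sub>0 \<xi> t))\<^sup>2)
                   \<ge> c' * (norm (adjoint (S T\<^sub>0) \<xi>))\<^sup>2) \<longrightarrow>
     (\<forall>x u. optimal_steady_pair D A B C z (x, u) \<longrightarrow>
        (\<exists>!y. y \<in> adj_dom D A \<and>
              - adj_op D A y - adjoint C (C x - z) = 0 \<and>
              u = - control_adj B y)))"
proof -
  interpret control_system D A S B by unfold_locales (rule assms)+
  obtain K where K: "K > 0"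
    "\<And>x u. (x, u) \<in> steady_pairs D A B \<Longrightarrow> norm (x, u) \<le> K * norm (C x, u)"
    using steady_pairs_coercive[OF assms(4,6,7)] assms(8) by blast
  have "\<forall>p\<in>steady_pairs D A B. norm p \<le> K * norm (outputs C p)"
    using K(2) by (auto simp: outputs_def)
  note opt = exists_unique_optimal_steady_pair[OF assms(4) K(1) this, where z = z]
  have adjoint_state: "\<exists>!y. y \<in> adj_dom D A \<and> - A' y - adjoint C (C x - z) = 0 \<and> u = - B' y"
    if ker: "{\<phi> \<in> adj_dom D A. A' \<phi> = 0} \<inter> {\<phi> \<in> adj_dom D A. B' \<phi> = 0} = {0}"
      and c': "c' > 0" "\<forall>\<xi>. (LINT t|lebesgue_on {0..T\<^sub>0}. (norm (observation D A S B T\<^sub>0 \<xi> t))\<^sup>2)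
                   \<ge> c' * (norm (S' T\<^sub>0 \<xi>))\<^sup>2"
      and xu: "optimal_steady_pair D A B C z (x, u)"
    for c' x u
  proof -
    obtain K' where K': "K' > 0" "\<And>y. y \<in> adj_dom D A \<Longrightarrow> norm y \<le> K' * norm (A' y, B' y)"
      using adjoint_coercive[OF assms(6,3) c'(1)] c'(2) by blast
    \<comment> \<open>The residual (z - C x, - u) is orthogonal to all outputs of steady pairs;
      moving C to the other side gives a vector annihilating the pairs themselves.\<close>
    have "inner p (adjoint C (z - C x), - u) = 0" if p: "p \<in> steady_pairs D A B" for p
      using opt(2)[OF xu p]
      by (cases p) (simp add: outputs_def adjoint_inner[OF assms(4), symmetric] inner_commute)
    then obtain y where y: "y \<in> adj_dom D A" "(adjoint C (z - C x), - u) = (A' y, B' y)"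
      using adjoint_range_eq_annihilator[OF K'] by blast
    have "adjoint C (z - C x) = - adjoint C (C x - z)"
      using linear_diff[OF bounded_linear.linear[OF bounded_linear_adjoint[OF assms(4)]]] by simp
    with y(2) have eq: "A' y = - adjoint C (C x - z)" "B' y = - u" by auto
    have ex: "- A' y - adjoint C (C x - z) = 0" "u = - B' y" unfolding eq by simp_all
    show ?thesis
    proof (rule ex1I[of _ y])
      fix y' assume y': "y' \<in> adj_dom D A \<and> - A' y' - adjoint C (C x - z) = 0 \<and> u = - B' y'"
      then have "- A' y' = - A' y" using ex(1) by simp
      \<comment> \<open>The difference of two adjoint states solves the homogeneous equations and so
        lies in both kernels.\<close>
      then have "A' (y' - y) = 0" "B' (y' - y) = 0" "y' - y \<in> adj_dom D A"
        using y(1) y' ex by (auto simp: adj_op_diff control_adj_linear)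
      then have "y' - y \<in> {0}" unfolding ker[symmetric] by blast
      then show "y' = y" by simp
    qed (use y ex in blast)
  qed
  show ?thesis
    by (intro conjI impI allI, rule opt(1), elim conjE exE, rule adjoint_state) assumption+
qed

end
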